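(* Suppose $W=\sum_{i=1}^n\gamma_ix^{v_i}$ is a complete Laurent polynomial on the torus $T$ with coefficients $\gamma_i\in\mathcal K_{>0}$. Then the unique positive critical point $p_{\mathrm{crit}}\in T(\mathbf K_{>0})$ of $W$ lies in $T(\mathcal K_{>0})$. In particular its valuation $d_{\mathrm{crit}}=\operatorname{Val}_T(p_{\mathrm{crit}})$ lies in $N_{\mathbb Q}=N\otimes\mathbb Q$.
   Context: $\mathbf K$ is the field of generalised Puiseux series $c(t)=\sum_kc_{\mu_k}t^{\mu_k}$, $c_{\mu_k}\in\mathbb C$, with real exponents forming a strictly increasing sequence that is finite or tends to $+\infty$; $\operatorname{Val}_{\mathbf K}$ is the lowest exponent with nonzero coefficient; $\mathbf K_{>0}$ is the set of nonzero series with leading coefficient in $\mathbb R_{>0}$. $\mathcal K=\bigcup_{\ell\in\mathbb Z_{>0}}\mathbb C((t^{1/\ell}))\subset\mathbf K$ is the subfield of Puiseux series and $\mathcal K_{>0}=\mathcal K\cap\mathbf K_{>0}$. $T$ is a split torus of dimension $r$ with character lattice $M\cong\mathbb Z^r$ and cocharacter lattice $N$, dual pairing $\langle\ ,\ \rangle$, $M_{\mathbb R}=M\otimes\mathbb R$, $N_{\mathbb R}=N\otimes\mathbb R$; $T(\mathbf K_{>0})=\operatorname{Hom}(M,\mathbf K_{>0})$, $T(\mathcal K_{>0})=\operatorname{Hom}(M,\mathcal K_{>0})$, and $p^v$ denotes the value of $p$ on $v\in M$. $\operatorname{Val}_T(p)\in N_{\mathbb R}$ is determined by $\operatorname{Val}_{\mathbf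 K}(p^v)=\langle v,\operatorname{Val}_T(p)\rangle$ for all $v\in M$. The exponents $v_i\in M$ are distinct, and $W$ is complete if $\operatorname{ConvexHull}(\{v_i\})\subset M_{\mathbb R}$ is $r$-dimensional with $0$ in its interior. A positive critical point is a $p\in T(\mathbf K_{>0})$ with $\sum_i\gamma_i\langle v_i,u\rangle p^{v_i}=0$ for all $u\in N$; a complete Laurent polynomial with coefficients in $\mathbf K_{>0}$ has exactly one. *)

theory Defs
  imports
    "HOL-Complex_Analysis.Complex_Analysis"
begin

section \<open>Generalised Puiseux series\<close>

text \<open>
  A set of reals is the range of a strictly increasing sequence that is finite or tends to
  infinity iff it meets every half-line \<open>{..B}\<close> in a finite set. The generalised Puiseux series
  \<open>\<Sum>k. c k * t powr \<mu> k\<close> is represented by its coefficient function on the exponents.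
\<close>

definition left_finite :: "(real \<Rightarrow> complex) \<Rightarrow> bool" where
  "left_finite f \<longleftrightarrow> (\<forall>B. finite {x. x \<le> B \<and> f x \<noteq> 0})"

typedef gpuiseux = "{f :: real \<Rightarrow> complex. left_finite f}"
  morphisms gp_coeff Abs_gpuiseux
  by (rule exI[of _ "\<lambda>_. 0"]) (simp add: left_finite_def)

setup_lifting type_definition_gpuiseux

lemma gp_eqI: "(\<And>x. gp_coeff f x = gp_coeff g x) \<Longrightarrow> f = g"
  by transfer auto

lemma finite_gp_coeff: "finite {x. x \<le> B \<and> gp_coeff f x \<noteq> 0}"
  using gp_coeff[of f] by (simp add: left_finite_def)

lemma left_finite_bdd_below:
  assumes "left_finite f"
  obtains m where "\<And>x. x < m \<Longrightarrow> f x = 0"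
proof -
  define S where "S = {x. x \<le> 0 \<and> f x \<noteq> 0}"
  have fin: "finite S" using assms by (simp add: S_def left_finite_def)
  have "f x = 0" if "x < Min (insert 0 S)" for x
  proof (rule ccontr)
    assume "f x \<noteq> 0"
    moreover have "x < 0" using that fin by (metis Min_le finite_insert insertI1 less_le_trans)
    ultimately have "x \<in> S" by (simp add: S_def)
    then have "Min (insert 0 S) \<le> x" using fin by simp
    with that show False by simp
  qed
  then show ?thesis using that by blast
qed

definition conv_coeff :: "(real \<Rightarrow> complex) \<Rightarrow> (real \<Rightarrow> complex) \<Rightarrow> real \<Rightarrow> complex" where
  "conv_coeff f g x = (\<Sum>a | f a \<noteq> 0 \<and> g (x - a) \<noteq> 0. f a * g (x - a))"

lemma conv_coeff_eq:
  assumes "finite A" "{a. f a \<noteq> 0 \<and> g (x - a) \<noteq> 0} \<subseteq> A"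
  shows "conv_coeff f g x = (\<Sum>a\<in>A. f a * g (x - a))"
  unfolding conv_coeff_def using assms by (intro sum.mono_neutral_left) auto

lemma conv_coeff_commute: "conv_coeff f g x = conv_coeff g f x"
  unfolding conv_coeff_def
  by (rule sum.reindex_bij_witness[of _ "\<lambda>a. x - a" "\<lambda>a. x - a"]) (auto simp: mult.commute)

lemma conv_coeff_below:
  assumes "\<And>x. x < m \<Longrightarrow> f x = 0" "\<And>x. x < n \<Longrightarrow> g x = 0" "x < m + n"
  shows "conv_coeff f g x = 0"
proof -
  have "{a. f a \<noteq> 0 \<and> g (x - a) \<noteq> 0} = {}"
  proof safe
    fix a assume "f a \<noteq> 0" "g (x - a) \<noteq> 0"
    then have "m \<le> a" "n \<le> x - a" using assms(1,2) by (meson not_le)+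
    with assms(3) show "a \<in> {}" by simp
  qed
  then show ?thesis unfolding conv_coeff_def by (simp only: sum.empty)
qed

lemma conv_coeff_eq_below:
  assumes f: "left_finite f" and g: "\<And>x. x < n \<Longrightarrow> g x = 0" and "x - n \<le> B"
  shows "conv_coeff f g x = (\<Sum>a | a \<le> B \<and> f a \<noteq> 0. f a * g (x - a))"
proof (rule conv_coeff_eq)
  show "finite {a. a \<le> B \<and> f a \<noteq> 0}" using f by (simp add: left_finite_def)
  show "{a. f a \<noteq> 0 \<and> g (x - a) \<noteq> 0} \<subseteq> {a. a \<le> B \<and> f a \<noteq> 0}"
  proof safe
    fix a assume "f a \<noteq> 0" "g (x - a) \<noteq> 0"
    then have "n \<le> x - a" using g by (meson not_le)
    with assms(3) show "a \<le> B" by simp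
  qed
qed

lemma left_finite_conv:
  assumes "left_finite f" "left_finite g"
  shows "left_finite (conv_coeff f g)"
proof -
  obtain m where m: "\<And>x. x < m \<Longrightarrow> f x = 0" using left_finite_bdd_below[OF assms(1)] by blast
  obtain n where n: "\<And>x. x < n \<Longrightarrow> g x = 0" using left_finite_bdd_below[OF assms(2)] by blast
  show ?thesis unfolding left_finite_def
  proof
    fix B
    define F where "F = {a. a \<le> B - n \<and> f a \<noteq> 0}"
    define G where "G = {a. a \<le> B - m \<and> g a \<noteq> 0}"
    have "{x. x \<le> B \<and> conv_coeff f g x \<noteq> 0} \<subseteq> (\<lambda>(a, b). a + b) ` (F \<times> G)"
    proof safe
      fix x assume x: "x \<le> B" "conv_coeff f g x \<noteq> 0"
      have "{a. f a \<noteq> 0 \<and> g (x - a) \<noteq> 0} \<noteq> {}"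
        using x(2) unfolding conv_coeff_def by (metis sum.empty)
      then obtain a where a: "f a \<noteq> 0" "g (x - a) \<noteq> 0" by blast
      then have "m \<le> a" "n \<le> x - a" using m n by (meson not_le)+
      with a x(1) have "(a, x - a) \<in> F \<times> G" by (auto simp: F_def G_def)
      then show "x \<in> (\<lambda>(a, b). a + b) ` (F \<times> G)" by (rule rev_image_eqI) simp
    qed
    moreover have "finite (F \<times> G)" using assms by (simp add: F_def G_def left_finite_def)
    ultimately show "finite {x. x \<le> B \<and> conv_coeff f g x \<noteq> 0}"
      by (meson finite_imageI finite_subset)
  qed
qed

lemma conv_coeff_assoc:
  assumes f: "left_finite f" and g: "left_finite g" and h: "left_finite h"
  shows "conv_coeff (conv_coeff f g) h x = conv_coeff f (conv_coeff g h) x"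
proof -
  obtain mf where mf: "\<And>x. x < mf \<Longrightarrow> f x = 0" using left_finite_bdd_below[OF f] by blast
  obtain mg where mg: "\<And>x. x < mg \<Longrightarrow> g x = 0" using left_finite_bdd_below[OF g] by blast
  obtain mh where mh: "\<And>x. x < mh \<Longrightarrow> h x = 0" using left_finite_bdd_below[OF h] by blast
  have fg: "conv_coeff f g x = 0" if "x < mf + mg" for x
    using conv_coeff_below[of mf f mg g x] mf mg that by blast
  have gh: "conv_coeff g h x = 0" if "x < mg + mh" for x
    using conv_coeff_below[of mg g mh h x] mg mh that by blast
  define A where "A = {a. a \<le> x - mg - mh \<and> f a \<noteq> 0}"
  define C where "C = {c. c \<le> x - mf - mg \<and> h c \<noteq> 0}"
  have "conv_coeff (conv_coeff f g) h x = conv_coeff h (conv_coeff f g) x"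
    by (rule conv_coeff_commute)
  also have "\<dots> = (\<Sum>c\<in>C. h c * conv_coeff f g (x - c))"
    unfolding C_def by (rule conv_coeff_eq_below[OF h fg]) auto
  also have "\<dots> = (\<Sum>c\<in>C. h c * (\<Sum>a\<in>A. f a * g (x - c - a)))"
  proof (rule sum.cong[OF refl])
    fix c assume "c \<in> C"
    then have "mh \<le> c" using mh by (auto simp: C_def not_less[symmetric])
    then have "conv_coeff f g (x - c) = (\<Sum>a\<in>A. f a * g (x - c - a))"
      unfolding A_def by (intro conv_coeff_eq_below[OF f mg]) auto
    then show "h c * conv_coeff f g (x - c) = h c * (\<Sum>a\<in>A. f a * g (x - c - a))" by simp
  qed
  also have "\<dots> = (\<Sum>a\<in>A. f a * (\<Sum>c\<in>C. h c * g (x - a - c)))"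
    by (simp add: sum_distrib_left sum.swap[of _ C A] algebra_simps)
  also have "\<dots> = (\<Sum>a\<in>A. f a * conv_coeff g h (x - a))"
  proof (rule sum.cong[OF refl])
    fix a assume "a \<in> A"
    then have "mf \<le> a" using mf by (auto simp: A_def not_less[symmetric])
    then have "conv_coeff h g (x - a) = (\<Sum>c\<in>C. h c * g (x - a - c))"
      unfolding C_def by (intro conv_coeff_eq_below[OF h mg]) auto
    then show "f a * (\<Sum>c\<in>C. h c * g (x - a - c)) = f a * conv_coeff g h (x - a)"
      by (simp add: conv_coeff_commute[of g h])
  qed
  also have "\<dots> = conv_coeff f (conv_coeff g h) x"
    unfolding A_def by (rule conv_coeff_eq_below[OF f gh, symmetric]) auto
  finally show ?thesis .
qed

text \<open>The series with the single term \<open>c * t powr a\<close>.\<close>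

lift_definition gp_monom :: "complex \<Rightarrow> real \<Rightarrow> gpuiseux" is
  "\<lambda>c a x. if x = a then c else 0"
proof -
  fix c :: complex and a :: real
  have "{x. x \<le> B \<and> (if x = a then c else 0) \<noteq> 0} \<subseteq> {a}" for B by auto
  then show "left_finite (\<lambda>x. if x = a then c else 0)"
    unfolding left_finite_def by (meson finite.emptyI finite.insertI finite_subset)
qed

instantiation gpuiseux :: comm_ring_1
begin

lift_definition zero_gpuiseux :: gpuiseux is "\<lambda>_. 0"
  by (simp add: left_finite_def)

definition one_gpuiseux :: gpuiseux where "1 = gp_monom 1 0"

lift_definition plus_gpuiseux :: "gpuiseux \<Rightarrow> gpuiseux \<Rightarrow> gpuiseux" is "\<lambda>f g x. f x + g x"
proof -
  fix f g assume *: "left_finite f" "left_finite g"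
  have "{x. x \<le> B \<and> f x + g x \<noteq> 0} \<subseteq> {x. x \<le> B \<and> f x \<noteq> 0} \<union> {x. x \<le> B \<and> g x \<noteq> 0}" for B
    by auto
  with * show "left_finite (\<lambda>x. f x + g x)"
    unfolding left_finite_def by (meson finite_Un finite_subset)
qed

lift_definition uminus_gpuiseux :: "gpuiseux \<Rightarrow> gpuiseux" is "\<lambda>f x. - f x"
  by (simp add: left_finite_def)

definition minus_gpuiseux :: "gpuiseux \<Rightarrow> gpuiseux \<Rightarrow> gpuiseux" where
  "f - g = f + - (g :: gpuiseux)"

lift_definition times_gpuiseux :: "gpuiseux \<Rightarrow> gpuiseux \<Rightarrow> gpuiseux" is conv_coeff
  by (rule left_finite_conv)

lemma gp_one_times: "1 * f = (f :: gpuiseux)"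
  unfolding one_gpuiseux_def
proof (transfer, rule ext)
  fix f :: "real \<Rightarrow> complex" and x
  have "conv_coeff (\<lambda>y. if y = 0 then 1 else 0) f x =
        (\<Sum>a\<in>{0}. (if a = 0 then 1 else 0) * f (x - a))"
    by (rule conv_coeff_eq) auto
  then show "conv_coeff (\<lambda>y. if y = 0 then 1 else 0) f x = f x" by simp
qed

lemma gp_distrib: "(f + g) * h = f * h + g * (h :: gpuiseux)"
proof (transfer, rule ext)
  fix f g h :: "real \<Rightarrow> complex" and x
  assume f: "left_finite f" and g: "left_finite g" and h: "left_finite h"
  obtain m where m: "\<And>x. x < m \<Longrightarrow> h x = 0" using left_finite_bdd_below[OF h] by blast
  define A where "A = {a. a \<le> x - m \<and> f a \<noteq> 0} \<union> {a. a \<le> x - m \<and> g a \<noteq> 0}"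
  have A: "finite A" using f g by (simp add: A_def left_finite_def)
  have le: "a \<le> x - m" if "h (x - a) \<noteq> 0" for a
    using that m[of "x - a"] by force
  have "conv_coeff f h x = (\<Sum>a\<in>A. f a * h (x - a))"
       "conv_coeff g h x = (\<Sum>a\<in>A. g a * h (x - a))"
       "conv_coeff (\<lambda>x. f x + g x) h x = (\<Sum>a\<in>A. (f a + g a) * h (x - a))"
    by (rule conv_coeff_eq[OF A]; use le in \<open>auto simp: A_def\<close>)+
  then show "conv_coeff (\<lambda>x. f x + g x) h x = conv_coeff f h x + conv_coeff g h x"
    by (simp add: distrib_right sum.distrib)
qed

instance
proof
  fix f g h :: gpuiseux
  show "f * g * h = f * (g * h)"
    by transfer (simp add: fun_eq_iff conv_coeff_assoc)
  show "f * g = g * f"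
    by transfer (simp add: fun_eq_iff conv_coeff_commute)
  show "1 * f = f" by (rule gp_one_times)
  show "f + g + h = f + (g + h)" by transfer (simp add: add.assoc)
  show "f + g = g + f" by transfer (simp add: add.commute)
  show "0 + f = f" by transfer simp
  show "- f + f = 0" by transfer simp
  show "f - g = f + - g" by (rule minus_gpuiseux_def)
  show "(f + g) * h = f * h + g * h" by (rule gp_distrib)
  show "(0 :: gpuiseux) \<noteq> 1"
    unfolding one_gpuiseux_def by transfer (auto simp: fun_eq_iff)
qed

end

lemma gp_coeff_zero [simp]: "gp_coeff 0 x = 0"
  by transfer simp

lemma gp_coeff_one: "gp_coeff 1 x = (if x = 0 then 1 else 0)"
  unfolding one_gpuiseux_def by transfer simp

lemma gp_coeff_monom: "gp_coeff (gp_monom c a) x = (if x = a then c else 0)"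
  by transfer simp

lemma gp_coeff_add [simp]: "gp_coeff (f + g) x = gp_coeff f x + gp_coeff g x"
  by transfer simp

lemma gp_coeff_uminus [simp]: "gp_coeff (- f) x = - gp_coeff f x"
  by transfer simp

lemma gp_coeff_diff [simp]: "gp_coeff (f - g) x = gp_coeff f x - gp_coeff g x"
  unfolding minus_gpuiseux_def by transfer simp

lemma gp_coeff_mult: "gp_coeff (f * g) x = conv_coeff (gp_coeff f) (gp_coeff g) x"
  by transfer simp

lemma gp_coeff_sum [simp]: "gp_coeff (\<Sum>i\<in>A. f i) x = (\<Sum>i\<in>A. gp_coeff (f i) x)"
  by (induction A rule: infinite_finite_induct) auto

lemma gp_coeff_monom_mult: "gp_coeff (gp_monom c a * f) x = c * gp_coeff f (x - a)"
proof -
  have "conv_coeff (gp_coeff (gp_monom c a)) (gp_coeff f) x =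
        (\<Sum>b\<in>{a}. gp_coeff (gp_monom c a) b * gp_coeff f (x - b))"
    by (rule conv_coeff_eq) (auto simp: gp_coeff_monom)
  then show ?thesis by (simp add: gp_coeff_mult gp_coeff_monom)
qed

lemma gp_coeff_mult_below:
  assumes "\<And>x. x < m \<Longrightarrow> gp_coeff f x = 0" "\<And>x. x < n \<Longrightarrow> gp_coeff g x = 0" "x < m + n"
  shows "gp_coeff (f * g) x = 0"
  unfolding gp_coeff_mult using assms by (rule conv_coeff_below)

subsection \<open>Valuation and leading coefficient\<close>

text \<open>Meaningful for nonzero series only; the value at \<open>0\<close> (infinity by convention) is irrelevant.\<close>

definition gp_val :: "gpuiseux \<Rightarrow> real" where
  "gp_val f = (LEAST x. gp_coeff f x \<noteq> 0)"

definition gp_lead :: "gpuiseux \<Rightarrow> complex" where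
  "gp_lead f = gp_coeff f (gp_val f)"

lemma gp_val_Least:
  assumes "f \<noteq> 0"
  shows "gp_coeff f (gp_val f) \<noteq> 0 \<and> (\<forall>y. gp_coeff f y \<noteq> 0 \<longrightarrow> gp_val f \<le> y)"
proof -
  obtain b where b: "gp_coeff f b \<noteq> 0" using assms gp_eqI[of f 0] by auto
  define S where "S = {x. x \<le> b \<and> gp_coeff f x \<noteq> 0}"
  have S: "finite S" "S \<noteq> {}" using b by (auto simp: S_def finite_gp_coeff)
  have 1: "gp_coeff f (Min S) \<noteq> 0" and 2: "Min S \<le> b"
    using Min_in[OF S] by (auto simp: S_def)
  have 3: "Min S \<le> y" if "gp_coeff f y \<noteq> 0" for y
  proof (cases "y \<le> b")
    case True
    with that S(1) show ?thesis by (auto simp: S_def intro!: Min_le)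
  qed (use 2 in auto)
  have "gp_val f = Min S" unfolding gp_val_def by (rule Least_equality) (use 1 3 in auto)
  with 1 3 show ?thesis by auto
qed

lemma gp_lead_nonzero: "f \<noteq> 0 \<Longrightarrow> gp_lead f \<noteq> 0"
  by (simp add: gp_lead_def gp_val_Least)

lemma gp_coeff_below_val: "x < gp_val f \<Longrightarrow> gp_coeff f x = 0"
  using gp_val_Least[of f] by (cases "f = 0") (simp, meson not_le)

lemma gp_val_eqI:
  assumes "gp_coeff f x \<noteq> 0" "\<And>y. y < x \<Longrightarrow> gp_coeff f y = 0"
  shows "gp_val f = x"
  unfolding gp_val_def by (rule Least_equality) (use assms in \<open>meson not_le\<close>)+

lemma gp_coeff_mult_val: "gp_coeff (f * g) (gp_val f + gp_val g) = gp_lead f * gp_lead g"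
proof -
  have "conv_coeff (gp_coeff f) (gp_coeff g) (gp_val f + gp_val g) =
        (\<Sum>a\<in>{gp_val f}. gp_coeff f a * gp_coeff g (gp_val f + gp_val g - a))"
  proof (rule conv_coeff_eq)
    show "{a. gp_coeff f a \<noteq> 0 \<and> gp_coeff g (gp_val f + gp_val g - a) \<noteq> 0} \<subseteq> {gp_val f}"
    proof safe
      fix a assume "gp_coeff f a \<noteq> 0" "gp_coeff g (gp_val f + gp_val g - a) \<noteq> 0"
      then have "\<not> a < gp_val f" "\<not> gp_val f + gp_val g - a < gp_val g"
        using gp_coeff_below_val by blast+
      then show "a = gp_val f" by simp
    qed
  qed simp
  then show ?thesis by (simp add: gp_coeff_mult gp_lead_def)
qed

lemma gp_mult_nonzero: "f \<noteq> 0 \<Longrightarrow> g \<noteq> 0 \<Longrightarrow> f * g \<noteq> (0 :: gpuiseux)"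
  using gp_coeff_mult_val[of f g] gp_lead_nonzero[of f] gp_lead_nonzero[of g] by auto

lemma gp_val_mult: "f \<noteq> 0 \<Longrightarrow> g \<noteq> 0 \<Longrightarrow> gp_val (f * g) = gp_val f + gp_val g"
proof (rule gp_val_eqI)
  assume "f \<noteq> 0" "g \<noteq> 0"
  then show "gp_coeff (f * g) (gp_val f + gp_val g) \<noteq> 0"
    by (simp add: gp_coeff_mult_val gp_lead_nonzero)
qed (rule gp_coeff_mult_below[OF gp_coeff_below_val gp_coeff_below_val])

lemma gp_lead_mult: "f \<noteq> 0 \<Longrightarrow> g \<noteq> 0 \<Longrightarrow> gp_lead (f * g) = gp_lead f * gp_lead g"
  unfolding gp_lead_def[of "f * g"] by (simp add: gp_val_mult gp_coeff_mult_val)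

lemma gp_val_monom: "c \<noteq> 0 \<Longrightarrow> gp_val (gp_monom c a) = a"
  by (intro gp_val_eqI) (auto simp: gp_coeff_monom)

lemma gp_lead_monom: "c \<noteq> 0 \<Longrightarrow> gp_lead (gp_monom c a) = c"
  by (simp add: gp_lead_def gp_val_monom gp_coeff_monom)

subsection \<open>The field structure\<close>

lemma gp_mult_cong:
  assumes "\<And>y. y < 0 \<Longrightarrow> gp_coeff f y = 0" "\<And>y. y \<le> x \<Longrightarrow> gp_coeff g y = gp_coeff h y"
  shows "gp_coeff (f * g) x = gp_coeff (f * h) x"
proof -
  have *: "gp_coeff g (x - a) = gp_coeff h (x - a)" if "gp_coeff f a \<noteq> 0" for a
  proof -
    have "0 \<le> a" using that assms(1)[of a] by (meson not_le)
    then show ?thesis by (intro assms(2)) simp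
  qed
  show ?thesis unfolding gp_coeff_mult conv_coeff_def
    by (rule sum.cong) (auto simp: *)
qed

text \<open>The geometric series: coefficients of \<open>\<Sum>k. g ^ k\<close> when \<open>g\<close> has positive valuation.\<close>

lemma gp_one_minus_inverse:
  fixes g :: gpuiseux
  assumes e: "0 < e" and g: "\<And>x. x < e \<Longrightarrow> gp_coeff g x = 0"
  shows "\<exists>h. (1 - g) * h = 1"
proof -
  have pow: "gp_coeff (g ^ k) x = 0" if "x < of_nat k * e" for k x
    using that
  proof (induction k arbitrary: x)
    case 0
    then show ?case by (simp add: gp_coeff_one)
  next
    case (Suc k)
    have "gp_coeff (g * g ^ k) x = 0"
    proof (rule gp_coeff_mult_below[OF g Suc.IH])
      show "x < e + of_nat k * e" using Suc.prems by (simp add: algebra_simps)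
    qed
    then show ?case by simp
  qed
  define N where "N x = nat \<lceil>x / e\<rceil>" for x
  have N: "x < of_nat (Suc (N x)) * e" for x
  proof -
    have "x / e \<le> of_nat (N x)" by (simp add: N_def of_nat_ceiling)
    then show ?thesis using e by (simp add: field_simps)
  qed
  define P where "P n = (\<Sum>k\<le>n. g ^ k)" for n
  have stab: "gp_coeff (P m) y = gp_coeff (P n) y" if "y < of_nat (Suc n) * e" "n \<le> m" for m n y
  proof -
    have "gp_coeff (g ^ k) y = 0" if "k \<in> {..m} - {..n}" for k
    proof (rule pow)
      have "real (Suc n) \<le> real k" using that by auto
      then have "of_nat (Suc n) * e \<le> of_nat k * e" using e by (intro mult_right_mono) auto
      then show "y < of_nat k * e" using \<open>y < of_nat (Suc n) * e\<close> by linarith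
    qed
    moreover have "{..n} \<subseteq> {..m}" using \<open>n \<le> m\<close> by simp
    ultimately show ?thesis unfolding P_def gp_coeff_sum
      by (intro sum.mono_neutral_right) blast+
  qed
  define H where "H x = gp_coeff (P (N x)) x" for x
  have H: "H y = gp_coeff (P (N x)) y" if "y \<le> x" for x y
  proof -
    have "N y \<le> N x" unfolding N_def using that e by (intro nat_mono ceiling_mono divide_right_mono) auto
    then show ?thesis unfolding H_def by (rule stab[OF N, symmetric])
  qed
  have "left_finite H" unfolding left_finite_def
  proof
    fix B
    have "{x. x \<le> B \<and> H x \<noteq> 0} = {x. x \<le> B \<and> gp_coeff (P (N B)) x \<noteq> 0}"
      by (rule Collect_cong) (use H[of _ B] in auto)
    then show "finite {x. x \<le> B \<and> H x \<noteq> 0}" by (simp add: finite_gp_coeff)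
  qed
  then have cH: "gp_coeff (Abs_gpuiseux H) = H" by (simp add: Abs_gpuiseux_inverse)
  have tele: "(1 - g) * P n = 1 - g ^ Suc n" for n
  proof (induction n)
    case (Suc n)
    have "(1 - g) * P (Suc n) = (1 - g) * P n + (1 - g) * g ^ Suc n"
      by (simp add: P_def distrib_left)
    also have "\<dots> = 1 - g ^ Suc (Suc n)" unfolding Suc by (simp add: algebra_simps)
    finally show ?case .
  qed (simp add: P_def)
  have "(1 - g) * Abs_gpuiseux H = 1"
  proof (rule gp_eqI)
    fix x
    have "gp_coeff ((1 - g) * Abs_gpuiseux H) x = gp_coeff ((1 - g) * P (N x)) x"
    proof (rule gp_mult_cong)
      show "gp_coeff (1 - g) y = 0" if "y < 0" for y
        using that g[of y] e by (simp add: gp_coeff_one)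
      show "gp_coeff (Abs_gpuiseux H) y = gp_coeff (P (N x)) y" if "y \<le> x" for y
        using H[OF that] by (simp add: cH)
    qed
    also have "\<dots> = gp_coeff 1 x" using pow[OF N[of x]] unfolding tele by simp
    finally show "gp_coeff ((1 - g) * Abs_gpuiseux H) x = gp_coeff 1 x" .
  qed
  then show ?thesis by blast
qed

lemma gp_monom_mult: "gp_monom c a * gp_monom d b = gp_monom (c * d) (a + b)"
  by (rule gp_eqI) (auto simp: gp_coeff_monom_mult gp_coeff_monom)

lemma gp_inverse_ex:
  assumes "f \<noteq> (0 :: gpuiseux)"
  shows "\<exists>h. f * h = 1"
proof -
  define u where "u = gp_monom (inverse (gp_lead f)) (- gp_val f)"
  define g where "g = 1 - u * f"
  have nz: "gp_lead f \<noteq> 0" using assms by (rule gp_lead_nonzero)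
  have g0: "gp_coeff g x = 0" if "x \<le> 0" for x
  proof (cases "x = 0")
    case True
    then show ?thesis using nz
      by (simp add: g_def u_def gp_coeff_monom_mult gp_coeff_one gp_lead_def)
  next
    case False
    with that have "x + gp_val f < gp_val f" by simp
    then have "gp_coeff f (x + gp_val f) = 0" by (rule gp_coeff_below_val)
    with False show ?thesis by (simp add: g_def u_def gp_coeff_monom_mult gp_coeff_one)
  qed
  have "\<exists>e>0. \<forall>x<e. gp_coeff g x = 0"
  proof (cases "g = 0")
    case True
    then show ?thesis by (intro exI[of _ 1]) simp
  next
    case False
    then have "gp_coeff g (gp_val g) \<noteq> 0" by (simp add: gp_val_Least)
    then have "0 < gp_val g" using g0 not_le by blast
    then show ?thesis using gp_coeff_below_val by blast
  qed
  then obtain h where "(1 - g) * h = 1" using gp_one_minus_inverse by blast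
  then have "f * (u * h) = 1" by (simp add: g_def algebra_simps)
  then show ?thesis by blast
qed

instantiation gpuiseux :: field
begin

definition inverse_gpuiseux :: "gpuiseux \<Rightarrow> gpuiseux" where
  "inverse (f :: gpuiseux) = (if f = 0 then 0 else (SOME h. f * h = 1))"

definition divide_gpuiseux :: "gpuiseux \<Rightarrow> gpuiseux \<Rightarrow> gpuiseux" where
  "f div g = f * inverse (g :: gpuiseux)"

instance
proof
  fix f g :: gpuiseux
  show "inverse f * f = 1" if "f \<noteq> 0"
    using someI_ex[OF gp_inverse_ex[OF that]] that
    by (simp add: inverse_gpuiseux_def mult.commute)
  show "f div g = f * inverse g" by (rule divide_gpuiseux_def)
  show "inverse (0 :: gpuiseux) = 0" by (simp add: inverse_gpuiseux_def)
qed

end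

subsection \<open>Positive series and the subfield of Puiseux series\<close>

definition gp_pos :: "gpuiseux set" where
  "gp_pos = {f. f \<noteq> 0 \<and> gp_lead f \<in> \<real> \<and> Re (gp_lead f) > 0}"

text \<open>The substitution \<open>F(t) \<mapsto> F(t powr (1 / l))\<close> for a formal Laurent series \<open>F\<close> and \<open>l > 0\<close>.\<close>

lift_definition gp_of_fls :: "nat \<Rightarrow> complex fls \<Rightarrow> gpuiseux" is
  "\<lambda>l F x. if l > 0 \<and> real l * x \<in> \<int> then fls_nth F \<lfloor>real l * x\<rfloor> else 0"
proof -
  fix l :: nat and F :: "complex fls"
  show "left_finite (\<lambda>x. if l > 0 \<and> real l * x \<in> \<int> then fls_nth F \<lfloor>real l * x\<rfloor> else 0)"
    unfolding left_finite_def
  proof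
    fix B
    have "{x. x \<le> B \<and> (if l > 0 \<and> real l * x \<in> \<int> then fls_nth F \<lfloor>real l * x\<rfloor> else 0) \<noteq> 0}
          \<subseteq> (\<lambda>k. of_int k / real l) ` {fls_subdegree F..\<lfloor>real l * B\<rfloor>}"
    proof safe
      fix x assume x: "x \<le> B"
        "(if l > 0 \<and> real l * x \<in> \<int> then fls_nth F \<lfloor>real l * x\<rfloor> else 0) \<noteq> 0"
      then have l: "l > 0" "real l * x \<in> \<int>" "fls_nth F \<lfloor>real l * x\<rfloor> \<noteq> 0"
        by (auto split: if_splits)
      then have "fls_subdegree F \<le> \<lfloor>real l * x\<rfloor>" by (simp add: fls_subdegree_leI)
      moreover have "\<lfloor>real l * x\<rfloor> \<le> \<lfloor>real l * B\<rfloor>"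
        using x(1) by (intro floor_mono mult_left_mono) auto
      moreover have "x = of_int \<lfloor>real l * x\<rfloor> / real l"
      proof -
        from l(2) obtain k where k: "real l * x = of_int k" by (rule Ints_cases)
        with l(1) have "x = of_int k / real l" by (simp add: field_simps)
        with k show ?thesis by simp
      qed
      ultimately show "x \<in> (\<lambda>k. of_int k / real l) ` {fls_subdegree F..\<lfloor>real l * B\<rfloor>}" by auto
    qed
    then show "finite {x. x \<le> B \<and>
        (if l > 0 \<and> real l * x \<in> \<int> then fls_nth F \<lfloor>real l * x\<rfloor> else 0) \<noteq> 0}"
      by (rule finite_subset) simp
  qed
qed

definition puiseux :: "gpuiseux set" where
  "puiseux = (\<Union>l\<in>{1..}. range (gp_of_fls l))"

definition puiseux_pos :: "gpuiseux set" where
  "puiseux_pos = puiseux \<inter> gp_pos"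

lemma puiseux_iff:
  "f \<in> puiseux \<longleftrightarrow> (\<exists>l>0. \<forall>x. gp_coeff f x \<noteq> 0 \<longrightarrow> real l * x \<in> \<int>)"
proof
  assume "f \<in> puiseux"
  then obtain l F where "l \<ge> 1" "f = gp_of_fls l F" unfolding puiseux_def by blast
  then show "\<exists>l>0. \<forall>x. gp_coeff f x \<noteq> 0 \<longrightarrow> real l * x \<in> \<int>"
    by (intro exI[of _ l]) (auto simp: gp_of_fls.rep_eq split: if_splits)
next
  assume "\<exists>l>0. \<forall>x. gp_coeff f x \<noteq> 0 \<longrightarrow> real l * x \<in> \<int>"
  then obtain l where l: "l > 0" "\<And>x. gp_coeff f x \<noteq> 0 \<Longrightarrow> real l * x \<in> \<int>" by blast
  define F where "F = Abs_fls (\<lambda>k::int. gp_coeff f (of_int k / real l))"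
  have F: "fls_nth F k = gp_coeff f (of_int k / real l)" for k
    unfolding F_def
  proof (rule nth_Abs_fls_lower_bound)
    show "\<forall>k<\<lfloor>real l * gp_val f\<rfloor>. gp_coeff f (of_int k / real l) = 0"
    proof safe
      fix k assume "k < \<lfloor>real l * gp_val f\<rfloor>"
      then have "of_int k < real l * gp_val f" by linarith
      then have "of_int k / real l < gp_val f" using l(1) by (simp add: field_simps)
      then show "gp_coeff f (of_int k / real l) = 0" by (rule gp_coeff_below_val)
    qed
  qed
  have "f = gp_of_fls l F"
  proof (rule gp_eqI)
    fix x
    show "gp_coeff f x = gp_coeff (gp_of_fls l F) x"
    proof (cases "real l * x \<in> \<int>")
      case True
      then obtain k where k: "real l * x = of_int k" by (rule Ints_cases)
      with l(1) have "x = of_int k / real l" by (simp add: field_simps)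
      with k l(1) show ?thesis by (simp add: gp_of_fls.rep_eq F)
    next
      case False
      with l(2) show ?thesis by (auto simp: gp_of_fls.rep_eq)
    qed
  qed
  moreover have "l \<in> {1..}" using l(1) by simp
  ultimately show "f \<in> puiseux" unfolding puiseux_def by blast
qed


section \<open>Points of the torus\<close>

text \<open>
  A basis of the character lattice is fixed, so \<open>M\<close> and \<open>N\<close> are both \<open>int ^ 'r\<close> with the standard
  pairing, and \<open>M \<otimes> \<real>\<close> and \<open>N \<otimes> \<real>\<close> are \<open>real ^ 'r\<close> with the inner product.
\<close>

definition lattice_pairing :: "int ^ 'r \<Rightarrow> int ^ 'r \<Rightarrow> int" where
  "lattice_pairing v u = (\<Sum>j\<in>UNIV. vec_nth v j * vec_nth u j)"

definition lattice_real :: "int ^ 'r \<Rightarrow> real ^ 'r" where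
  "lattice_real v = (\<chi> j. real_of_int (vec_nth v j))"

definition rational_points :: "(real ^ 'r) set" where
  "rational_points = {d. \<forall>j. vec_nth d j \<in> \<rat>}"

text \<open>
  For a multiplicative subgroup \<open>P\<close> of the field, these are the group homomorphisms \<open>M \<rightarrow> P\<close>
  (which automatically satisfy \<open>p 0 = 1\<close>).
\<close>

definition torus_points :: "gpuiseux set \<Rightarrow> (int ^ 'r \<Rightarrow> gpuiseux) set" where
  "torus_points P = {p. (\<forall>v. p v \<in> P) \<and> (\<forall>v w. p (v + w) = p v * p w)}"

definition torus_val :: "(int ^ 'r \<Rightarrow> gpuiseux) \<Rightarrow> real ^ 'r" where
  "torus_val p = (THE d. \<forall>v. gp_val (p v) = inner (lattice_real v) d)"

lemma torus_val_unique:
  fixes p :: "int ^ 'r \<Rightarrow> gpuiseux"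
  assumes p: "p \<in> torus_points gp_pos"
  shows "\<exists>!d. \<forall>v. gp_val (p v) = inner (lattice_real v) d"
proof -
  define \<phi> where "\<phi> v = gp_val (p v)" for v
  have add: "\<phi> (v + w) = \<phi> v + \<phi> w" for v w
    using p by (simp add: \<phi>_def torus_points_def gp_pos_def gp_val_mult)
  have zero: "\<phi> 0 = 0" using add[of 0 0] by simp
  have minus: "\<phi> (- v) = - \<phi> v" for v using add[of v "- v"] zero by simp
  have nat: "\<phi> (of_nat k *s v) = of_nat k * \<phi> v" for k v
  proof (induction k)
    case (Suc k)
    have "of_nat (Suc k) *s v = v + of_nat k *s v" by (simp add: vec_eq_iff algebra_simps)
    then show ?case by (simp only: add Suc) (simp add: algebra_simps)
  qed (simp add: zero)
  have int: "\<phi> (k *s v) = of_int k * \<phi> v" for k v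
  proof (cases "k \<ge> 0")
    case True
    then show ?thesis using nat[of "nat k" v] by simp
  next
    case False
    have "k *s v = - (of_nat (nat (- k)) *s v)" using False by (simp add: vec_eq_iff)
    then have "\<phi> (k *s v) = - \<phi> (of_nat (nat (- k)) *s v)" by (simp only: minus)
    also have "\<dots> = of_int k * \<phi> v" unfolding nat using False by simp
    finally show ?thesis .
  qed
  have sum: "\<phi> (\<Sum>j\<in>A. f j) = (\<Sum>j\<in>A. \<phi> (f j))" for A and f :: "'r \<Rightarrow> int ^ 'r"
  proof (induction A rule: infinite_finite_induct)
    case (insert x A)
    then show ?case by (simp add: add)
  qed (simp_all add: zero)
  have phi: "\<phi> v = inner (lattice_real v) (\<chi> j. \<phi> (axis j 1))" for v
  proof -
    have "\<phi> v = \<phi> (\<Sum>j\<in>UNIV. vec_nth v j *s axis j 1)"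
      by (simp only: basis_expansion)
    also have "\<dots> = inner (lattice_real v) (\<chi> j. \<phi> (axis j 1))"
      unfolding sum int inner_vec_def lattice_real_def by simp
    finally show ?thesis .
  qed
  show ?thesis
  proof (rule ex1I)
    show "\<forall>v. gp_val (p v) = inner (lattice_real v) (\<chi> j. \<phi> (axis j 1))"
      using phi unfolding \<phi>_def by blast
    fix d assume d: "\<forall>v. gp_val (p v) = inner (lattice_real v) d"
    have "lattice_real (axis j 1) = axis j 1" for j :: 'r
      by (simp add: lattice_real_def vec_eq_iff axis_def)
    then have "\<phi> (axis j 1) = vec_nth d j" for j
      using d by (simp add: \<phi>_def inner_axis')
    then show "d = (\<chi> j. \<phi> (axis j 1))" by (simp add: vec_eq_iff)
  qed
qed

lemma torus_val:
  assumes "p \<in> torus_points gp_pos"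
  shows "gp_val (p v) = inner (lattice_real v) (torus_val p)"
  using theI'[OF torus_val_unique[OF assms]] unfolding torus_val_def by blast


section \<open>Laurent polynomials and positive critical points\<close>

text \<open>
  The Laurent polynomial \<open>\<Sum>i=1..n. \<gamma> i * x ^ v i\<close> is given by \<open>n\<close>, \<open>\<gamma>\<close> and \<open>v\<close>.
\<close>

definition complete_exponents :: "nat \<Rightarrow> (nat \<Rightarrow> int ^ 'r) \<Rightarrow> bool" where
  "complete_exponents n v \<longleftrightarrow>
     aff_dim (convex hull ((\<lambda>i. lattice_real (v i)) ` {1..n})) = int CARD('r) \<and>
     0 \<in> interior (convex hull ((\<lambda>i. lattice_real (v i)) ` {1..n}))"

definition positive_critical_point ::
    "nat \<Rightarrow> (nat \<Rightarrow> gpuiseux) \<Rightarrow> (nat \<Rightarrow> int ^ 'r) \<Rightarrow> (int ^ 'r \<Rightarrow> gpuiseux) \<Rightarrow> bool" where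
  "positive_critical_point n \<gamma> v p \<longleftrightarrow>
     p \<in> torus_points gp_pos \<and>
     (\<forall>u. (\<Sum>i=1..n. \<gamma> i * of_int (lattice_pairing (v i) u) * p (v i)) = 0)"

definition p_crit ::
    "nat \<Rightarrow> (nat \<Rightarrow> gpuiseux) \<Rightarrow> (nat \<Rightarrow> int ^ 'r) \<Rightarrow> int ^ 'r \<Rightarrow> gpuiseux" where
  "p_crit n \<gamma> v = (THE p. positive_critical_point n \<gamma> v p)"

end

(*
  Uniqueness and the Newton estimates rest on one principle: a nonempty sum of elements of K_{>0} does
  not vanish. Hence if the terms k_i satisfy sum_i k_i v_i = 0 and <v_i, u> k_i is positive whenever
  <v_i, u> is nonzero, then u = 0. Applied to the terms of W at two critical points, with u the
  difference of their valuations and then of their logarithmic leading coefficients, this shows that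
  they agree to leading order; applied with u the conjugate of the lowest coefficient of z, it bounds
  solutions z of sum_i m_i (<v_i, z> - delta_i) v_i = 0 by the delta_i, uniformly in positive m_i.

  For existence, the leading term of the critical point is read off from the asymptotics as t -> 0 of
  the minimiser of the real Laurent polynomial sum_i lead(gamma_i) t^val(gamma_i) x^(v_i), and Newton
  iteration converges from there by the uniform bound.

  If the valuation d were irrational, take a Q-linear functional rho on R that kills Q but not some
  coordinate of d. Pairing the critical equation with rho(d) weights the i-th term by rho of its
  valuation, so all terms of lowest valuation get the same nonzero weight and cannot cancel. Finally,
  if the exponents of all gamma_i and of d lie in (1/L) Z, the automorphism
  t^x -> exp(2 pi i L x) t^x fixes W and preserves positivity of the critical point, hence fixes it by
  uniqueness; its fixed series are those with exponents in (1/L) Z.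
*)
theory Submission
  imports Defs
begin

section \<open>Orders of vanishing and positive series\<close>

text \<open>The series of valuation at least \<open>\<mu>\<close>, stated through coefficients so
  that \<open>0\<close> belongs without a convention for its valuation.\<close>

definition gp_O :: "real \<Rightarrow> gpuiseux set" where
  "gp_O \<mu> = {f. \<forall>y<\<mu>. gp_coeff f y = 0}"

lemma gp_O_zero [simp]: "0 \<in> gp_O \<mu>"
  by (simp add: gp_O_def)

lemma gp_O_add: "f \<in> gp_O \<mu> \<Longrightarrow> g \<in> gp_O \<mu> \<Longrightarrow> f + g \<in> gp_O \<mu>"
  by (simp add: gp_O_def)

lemma gp_O_diff: "f \<in> gp_O \<mu> \<Longrightarrow> g \<in> gp_O \<mu> \<Longrightarrow> f - g \<in> gp_O \<mu>"
  by (simp add: gp_O_def)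

lemma gp_O_uminus: "f \<in> gp_O \<mu> \<Longrightarrow> - f \<in> gp_O \<mu>"
  by (simp add: gp_O_def)

lemma gp_O_sum: "(\<And>i. i \<in> A \<Longrightarrow> f i \<in> gp_O \<mu>) \<Longrightarrow> sum f A \<in> gp_O \<mu>"
  by (simp add: gp_O_def)

lemma gp_O_mono: "f \<in> gp_O \<nu> \<Longrightarrow> \<mu> \<le> \<nu> \<Longrightarrow> f \<in> gp_O \<mu>"
  by (simp add: gp_O_def)

lemma gp_O_mult: "f \<in> gp_O \<mu> \<Longrightarrow> g \<in> gp_O \<nu> \<Longrightarrow> f * g \<in> gp_O (\<mu> + \<nu>)"
  unfolding gp_O_def by (auto intro: gp_coeff_mult_below[of \<mu> f \<nu> g])

lemma gp_O_mult0: "f \<in> gp_O 0 \<Longrightarrow> g \<in> gp_O \<mu> \<Longrightarrow> f * g \<in> gp_O \<mu>"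
  using gp_O_mult[of f 0 g \<mu>] by simp

lemma gp_O_val: "f \<in> gp_O (gp_val f)"
  by (simp add: gp_O_def gp_coeff_below_val)

lemma gp_O_le_val: "f \<in> gp_O \<mu> \<Longrightarrow> f \<noteq> 0 \<Longrightarrow> \<mu> \<le> gp_val f"
  using gp_val_Least[of f] by (force simp: gp_O_def not_less[symmetric])

lemma of_nat_gp: "(of_nat n :: gpuiseux) = gp_monom (of_nat n) 0"
  by (induction n) (auto intro!: gp_eqI simp: gp_coeff_monom gp_coeff_one)

lemma of_int_gp: "(of_int n :: gpuiseux) = gp_monom (of_int n) 0"
  by (cases n rule: int_cases2) (auto intro!: gp_eqI simp: of_nat_gp gp_coeff_monom)

lemma gp_coeff_const_mult [simp]: "gp_coeff (gp_monom c 0 * f) x = c * gp_coeff f x"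
  by (simp add: gp_coeff_monom_mult)

lemma gp_coeff_of_int_mult [simp]: "gp_coeff (of_int k * f) x = of_int k * gp_coeff f x"
  by (simp add: of_int_gp)

lemma gp_monom_0 [simp]: "gp_monom 0 a = 0"
  by (rule gp_eqI) (simp add: gp_coeff_monom)

lemma gp_O_one [simp]: "1 \<in> gp_O 0"
  by (simp add: gp_O_def gp_coeff_one)

lemma gp_O_const_mult: "f \<in> gp_O \<mu> \<Longrightarrow> gp_monom c 0 * f \<in> gp_O \<mu>"
  by (simp add: gp_O_def)

lemma gp_O_of_int_mult: "f \<in> gp_O \<mu> \<Longrightarrow> of_int k * f \<in> gp_O \<mu>"
  by (simp add: gp_O_def)

lemma gp_coeff_mult_O:
  assumes "f \<in> gp_O \<mu>" "g \<in> gp_O \<nu>"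
  shows "gp_coeff (f * g) (\<mu> + \<nu>) = gp_coeff f \<mu> * gp_coeff g \<nu>"
proof -
  have "conv_coeff (gp_coeff f) (gp_coeff g) (\<mu> + \<nu>) =
        (\<Sum>a\<in>{\<mu>}. gp_coeff f a * gp_coeff g (\<mu> + \<nu> - a))"
  proof (rule conv_coeff_eq)
    show "{a. gp_coeff f a \<noteq> 0 \<and> gp_coeff g (\<mu> + \<nu> - a) \<noteq> 0} \<subseteq> {\<mu>}"
    proof safe
      fix a assume "gp_coeff f a \<noteq> 0" "gp_coeff g (\<mu> + \<nu> - a) \<noteq> 0"
      with assms have "\<not> a < \<mu>" "\<not> \<mu> + \<nu> - a < \<nu>" unfolding gp_O_def by auto
      then show "a = \<mu>" by simp
    qed
  qed simp
  then show ?thesis by (simp add: gp_coeff_mult)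
qed

text \<open>Completeness: the coefficient at \<open>y\<close> is constant once
  \<open>of_nat n * e\<close> exceeds \<open>y\<close>, and up to any exponent \<open>B\<close> the
  limit agrees with the single series \<open>f (N B)\<close>, which makes it left-finite.\<close>

lemma gp_lim:
  assumes e: "0 < e" and step: "\<And>n. f (Suc n) - f n \<in> gp_O (of_nat n * e)"
  obtains g where "\<And>n. g - f n \<in> gp_O (of_nat n * e)"
proof -
  have far: "f m - f n \<in> gp_O (of_nat n * e)" if "n \<le> m" for m n
    using that
  proof (induction m rule: dec_induct)
    case (step k)
    have "f (Suc k) - f k \<in> gp_O (of_nat n * e)"
      using assms(2)[of k] e \<open>n \<le> k\<close> by (rule_tac gp_O_mono) (auto intro!: mult_right_mono)
    from gp_O_add[OF this step.IH] show ?case by simp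
  qed simp
  define N where "N y = Suc (nat \<lceil>y / e\<rceil>)" for y
  have N: "y < of_nat (N y) * e" for y
  proof -
    have "y / e \<le> of_nat (nat \<lceil>y / e\<rceil>)" by (rule of_nat_ceiling)
    then have "y / e < of_nat (N y)" by (simp add: N_def)
    then show ?thesis using e by (simp add: field_simps)
  qed
  have stable: "gp_coeff (f m) y = gp_coeff (f n) y" if "y < of_nat n * e" "n \<le> m" for m n y
    using far[OF that(2)] that(1) by (simp add: gp_O_def)
  define H where "H y = gp_coeff (f (N y)) y" for y
  have H: "H y = gp_coeff (f n) y" if "y < of_nat n * e" for n y
    using stable[of y n "max n (N y)"] stable[of y "N y" "max n (N y)"] N[of y] that
    by (simp add: H_def)
  have "left_finite H" unfolding left_finite_def
  proof
    fix B
    have "{x. x \<le> B \<and> H x \<noteq> 0} = {x. x \<le> B \<and> gp_coeff (f (N B)) x \<noteq> 0}"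
      by (intro Collect_cong conj_cong refl) (use H[of _ "N B"] N[of B] in force)
    then show "finite {x. x \<le> B \<and> H x \<noteq> 0}" by (simp add: finite_gp_coeff)
  qed
  then have "gp_coeff (Abs_gpuiseux H) = H" by (simp add: Abs_gpuiseux_inverse)
  then have "Abs_gpuiseux H - f n \<in> gp_O (of_nat n * e)" for n
    by (simp add: gp_O_def H)
  then show ?thesis by (rule that)
qed

lemma gp_O_all_zero:
  assumes e: "0 < e" and f: "\<And>n::nat. f \<in> gp_O (c + of_nat n * e)"
  shows "f = 0"
proof (rule ccontr)
  assume "f \<noteq> 0"
  then have "c + of_nat n * e \<le> gp_val f" for n using f gp_O_le_val by blast
  moreover obtain n :: nat where "gp_val f - c < of_nat n * e"
    using reals_Archimedean3[OF e] by blast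
  ultimately show False by (smt (verit))
qed

section \<open>Positive series: closure properties and non-cancellation\<close>

lemma gp_posI:
  assumes "f \<in> gp_O \<mu>" "gp_coeff f \<mu> = of_real c" "c > 0"
  shows "f \<in> gp_pos" "gp_val f = \<mu>" "gp_lead f = of_real c"
proof -
  show v: "gp_val f = \<mu>" using assms by (intro gp_val_eqI) (auto simp: gp_O_def)
  then show "gp_lead f = of_real c" using assms by (simp add: gp_lead_def)
  then show "f \<in> gp_pos" using assms by (auto simp: gp_pos_def)
qed

lemma gp_posD:
  assumes "f \<in> gp_pos"
  shows "f \<noteq> 0" "of_real (Re (gp_lead f)) = gp_lead f" "Re (gp_lead f) > 0"
  using assms by (auto simp: gp_pos_def)

lemma gp_pos_mult: "f \<in> gp_pos \<Longrightarrow> g \<in> gp_pos \<Longrightarrow> f * g \<in> gp_pos"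
  by (auto simp: gp_pos_def gp_lead_mult elim!: Reals_cases)

lemma gp_pos_one [simp]: "1 \<in> gp_pos"
  by (rule gp_posI[of _ 0 1]) (auto simp: gp_coeff_one)

lemma gp_val_one [simp]: "gp_val 1 = 0"
  by (rule gp_posI[of _ 0 1]) (auto simp: gp_coeff_one)

lemma gp_lead_one [simp]: "gp_lead 1 = 1"
  by (simp add: gp_lead_def gp_coeff_one)

lemma gp_val_inverse: "f \<noteq> 0 \<Longrightarrow> gp_val (inverse f) = - gp_val f"
  using gp_val_mult[of f "inverse f"] by simp

lemma gp_lead_inverse: "f \<noteq> 0 \<Longrightarrow> gp_lead (inverse f) = inverse (gp_lead f)"
  using gp_lead_mult[of f "inverse f"] gp_lead_nonzero[of f] by (simp add: field_simps)

lemma gp_pos_inverse: "f \<in> gp_pos \<Longrightarrow> inverse f \<in> gp_pos"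
  by (auto simp: gp_pos_def gp_lead_inverse simp flip: of_real_inverse elim!: Reals_cases)

lemma gp_pos_monom: "c > 0 \<Longrightarrow> gp_monom (of_real c) a \<in> gp_pos"
  by (rule gp_posI[of _ a c]) (auto simp: gp_coeff_monom gp_O_def)

lemma gp_pos_powi: "f \<in> gp_pos \<Longrightarrow> f powi k \<in> gp_pos"
proof -
  assume f: "f \<in> gp_pos"
  have "g ^ n \<in> gp_pos" if "g \<in> gp_pos" for g n
    using that by (induction n) (auto intro: gp_pos_mult)
  with f show ?thesis by (auto simp: power_int_def gp_pos_inverse)
qed

lemma gp_pos_prod: "(\<And>i. i \<in> A \<Longrightarrow> f i \<in> gp_pos) \<Longrightarrow> prod f A \<in> gp_pos"
  by (induction A rule: infinite_finite_induct) (auto intro: gp_pos_mult)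

text \<open>The lower valuation alone decides the sign, so this applies to differences as well as to
  sums.\<close>

lemma gp_pos_add_dominated:
  assumes "f \<in> gp_pos" "gp_val f < gp_val g"
  shows "f + g \<in> gp_pos"
proof (rule gp_posI(1))
  show "f + g \<in> gp_O (gp_val f)"
    using assms gp_O_val[of f] gp_O_val[of g] by (auto intro!: gp_O_add intro: gp_O_mono)
  show "gp_coeff (f + g) (gp_val f) = of_real (Re (gp_lead f))"
    using assms gp_posD(2)[of f] by (simp add: gp_coeff_below_val gp_lead_def)
qed (use assms gp_posD(3) in blast)

lemma gp_pos_add:
  assumes "f \<in> gp_pos" "g \<in> gp_pos"
  shows "f + g \<in> gp_pos"
proof (cases "gp_val f" "gp_val g" rule: linorder_cases)
  case less
  then show ?thesis using assms by (simp add: gp_pos_add_dominated)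
next
  case greater
  then show ?thesis using assms gp_pos_add_dominated[of g f] by (simp add: add.commute)
next
  case equal
  show ?thesis
  proof (rule gp_posI(1))
    show "f + g \<in> gp_O (gp_val f)"
      using equal gp_O_val[of f] gp_O_val[of g] by (auto intro!: gp_O_add)
    show "gp_coeff (f + g) (gp_val f) = of_real (Re (gp_lead f) + Re (gp_lead g))"
      using assms gp_posD(2)[of f] gp_posD(2)[of g] equal by (simp add: gp_lead_def)
  qed (use assms in \<open>simp add: gp_posD(3) add_pos_pos\<close>)
qed

text \<open>The non-cancellation principle: positive leading coefficients cannot cancel, and
  \<open>gp_pos\<close> excludes \<open>0\<close>.\<close>

lemma gp_pos_sum:
  assumes "finite A" "A \<noteq> {}" "\<And>i. i \<in> A \<Longrightarrow> f i \<in> gp_pos"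
  shows "sum f A \<in> gp_pos"
  using assms by (induction rule: finite_ne_induct) (auto intro: gp_pos_add)

lemma gp_pos_scale: "f \<in> gp_pos \<Longrightarrow> c > 0 \<Longrightarrow> gp_monom (of_real c) 0 * f \<in> gp_pos"
  by (intro gp_pos_mult gp_pos_monom)

subsection \<open>Principal units and monomials\<close>

lemma gp_unit_pos:
  assumes "z \<in> gp_O \<mu>" "\<mu> > 0"
  shows "1 + z \<in> gp_pos" "gp_val (1 + z) = 0" "gp_lead (1 + z) = 1"
proof -
  have 1: "1 + z \<in> gp_O 0" using assms by (auto intro!: gp_O_add intro: gp_O_mono)
  have 2: "gp_coeff (1 + z) 0 = of_real 1" using assms by (simp add: gp_O_def gp_coeff_one)
  show "1 + z \<in> gp_pos" "gp_val (1 + z) = 0" "gp_lead (1 + z) = 1"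
    using gp_posI[OF 1 2] by auto
qed

lemma gp_unit_inverse:
  assumes "z \<in> gp_O \<mu>" "\<mu> > 0"
  shows "inverse (1 + z) \<in> gp_O 0"
  using gp_unit_pos[OF assms] gp_O_val[of "inverse (1 + z)"] gp_posD(1)[of "1 + z"]
  by (simp add: gp_val_inverse)

text \<open>First-order expansions at 1 multiply by adding their linear parts, since the cross term
  \<open>a * b\<close> already has order \<open>2 * \<mu>\<close>.\<close>

lemma gp_unit_mult:
  fixes y z :: gpuiseux
  assumes "y - 1 - a \<in> gp_O (2 * \<mu>)" "z - 1 - b \<in> gp_O (2 * \<mu>)" "a \<in> gp_O \<mu>" "b \<in> gp_O \<mu>" "\<mu> > 0"
  shows "y * z - 1 - (a + b) \<in> gp_O (2 * \<mu>)"
proof -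
  define r s where "r = y - 1 - a" "s = z - 1 - b"
  have r: "r \<in> gp_O (2 * \<mu>)" "s \<in> gp_O (2 * \<mu>)" using assms by (auto simp: r_s_def)
  have "1 + b + s \<in> gp_O 0" using r assms
    by (auto intro!: gp_O_add intro: gp_O_mono)
  then have "r * (1 + b + s) \<in> gp_O (2 * \<mu>)" using r gp_O_mult[of r "2 * \<mu>" "1 + b + s" 0] by simp
  moreover have "a * b \<in> gp_O (2 * \<mu>)" using gp_O_mult[OF assms(3,4)] by simp
  moreover have "1 + a \<in> gp_O 0" using assms by (auto intro!: gp_O_add intro: gp_O_mono)
  then have "(1 + a) * s \<in> gp_O (2 * \<mu>)" using r gp_O_mult0 by blast
  ultimately have "a * b + (1 + a) * s + r * (1 + b + s) \<in> gp_O (2 * \<mu>)" by (intro gp_O_add)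
  then show ?thesis by (simp add: r_s_def algebra_simps)
qed

lemma gp_unit_powi:
  assumes z: "z \<in> gp_O \<mu>" and \<mu>: "\<mu> > 0"
  shows "(1 + z) powi k - 1 - of_int k * z \<in> gp_O (2 * \<mu>)"
proof -
  \<comment> \<open>The error of the inverse is exactly \<open>inverse (1 + z) * (z * z)\<close>;
    negative exponents then become powers of the inverse, with linear part
    \<open>- z\<close>.\<close>
  have inv: "inverse (1 + z) - 1 - (- z) \<in> gp_O (2 * \<mu>)"
  proof -
    have "1 + z \<noteq> 0" using gp_unit_pos[OF z \<mu>] gp_posD by blast
    then have "inverse (1 + z) - 1 - (- z) = inverse (1 + z) * (z * z)"
      by (simp add: field_simps)
    moreover have "z * z \<in> gp_O (2 * \<mu>)" using gp_O_mult[OF z z] by simp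
    ultimately show ?thesis using gp_O_mult0[OF gp_unit_inverse[OF z \<mu>]] by metis
  qed
  have pow: "y ^ n - 1 - of_int (int n) * a \<in> gp_O (2 * \<mu>)"
    if "y - 1 - a \<in> gp_O (2 * \<mu>)" "a \<in> gp_O \<mu>" for y a :: gpuiseux and n
  proof (induction n)
    case (Suc n)
    have "y * y ^ n - 1 - (a + of_int (int n) * a) \<in> gp_O (2 * \<mu>)"
      using that Suc \<mu> by (intro gp_unit_mult gp_O_of_int_mult)
    then show ?case by (simp add: algebra_simps)
  qed simp
  show ?thesis
  proof (cases "k \<ge> 0")
    case True
    then show ?thesis using pow[of "1 + z" z "nat k"] z by (simp add: power_int_def)
  next
    case False
    then have "of_int (int (nat (- k))) * (- z) = of_int k * z" by simp
    with False show ?thesis using pow[OF inv gp_O_uminus[OF z], of "nat (- k)"]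
      by (simp add: power_int_def)
  qed
qed

definition gp_mon :: "gpuiseux ^ 'r \<Rightarrow> int ^ 'r \<Rightarrow> gpuiseux" where
  "gp_mon x v = (\<Prod>j\<in>UNIV. x $ j powi (v $ j))"

lemma gp_mon_pos: "(\<And>j. x $ j \<in> gp_pos) \<Longrightarrow> gp_mon x v \<in> gp_pos"
  unfolding gp_mon_def by (intro gp_pos_prod gp_pos_powi)

lemma gp_mon_mult: "gp_mon (\<chi> j. x $ j * y $ j) v = gp_mon x v * gp_mon y v"
  by (simp add: gp_mon_def power_int_mult_distrib prod.distrib)

lemma gp_mon_add: "(\<And>j. x $ j \<noteq> 0) \<Longrightarrow> gp_mon x (v + w) = gp_mon x v * gp_mon x w"
  by (simp add: gp_mon_def power_int_add prod.distrib)

text \<open>Linearisation of a character at the identity; this quadratic error drives both the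
  uniqueness argument and the Newton iteration.\<close>

lemma gp_mon_unit:
  fixes z :: "gpuiseux ^ 'r"
  assumes z: "\<And>j. z $ j \<in> gp_O \<mu>" and \<mu>: "\<mu> > 0"
  shows "gp_mon (\<chi> j. 1 + z $ j) v - 1 - (\<Sum>j\<in>UNIV. of_int (v $ j) * z $ j) \<in> gp_O (2 * \<mu>)"
proof -
  have "(\<Prod>j\<in>A. (1 + z $ j) powi (v $ j)) - 1 - (\<Sum>j\<in>A. of_int (v $ j) * z $ j) \<in> gp_O (2 * \<mu>)"
    if "finite A" for A
    using that
  proof (induction A)
    case (insert j A)
    have "(1 + z $ j) powi (v $ j) * (\<Prod>j\<in>A. (1 + z $ j) powi (v $ j)) - 1
        - (of_int (v $ j) * z $ j + (\<Sum>j\<in>A. of_int (v $ j) * z $ j)) \<in> gp_O (2 * \<mu>)"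
      using insert.IH z \<mu> by (intro gp_unit_mult gp_unit_powi gp_O_sum gp_O_of_int_mult)
    with insert.hyps show ?case by simp
  qed simp
  from this[of UNIV] show ?thesis by (simp add: gp_mon_def)
qed

lemma gp_mon_monom:
  "gp_mon (\<chi> j. gp_monom (of_real (exp (a $ j))) (d $ j)) v =
   gp_monom (of_real (exp (lattice_real v \<bullet> a))) (lattice_real v \<bullet> d)"
proof -
  have nat: "gp_monom c e ^ k = gp_monom (c ^ k) (of_nat k * e)" for c e k
    by (induction k) (auto simp: gp_monom_mult one_gpuiseux_def algebra_simps)
  have inv: "inverse (gp_monom c e) = gp_monom (inverse c) (- e)" if "c \<noteq> 0" for c e
    using that by (intro inverse_unique) (simp add: gp_monom_mult one_gpuiseux_def)
  have powi: "gp_monom (of_real (exp s)) e powi k = gp_monom (of_real (exp (of_int k * s))) (of_int k * e)"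
    for s e :: real and k
  proof (cases "k \<ge> 0")
    case True
    then have "of_int k = real (nat k)" by simp
    with True show ?thesis by (simp add: power_int_def nat exp_of_nat_mult del: of_nat_nat)
  next
    case False
    then have k: "of_int k = - real (nat (- k))" by simp
    with False show ?thesis
      by (simp add: power_int_def nat inv exp_of_nat_mult exp_minus power_inverse del: of_nat_nat)
  qed
  have "(\<Prod>j\<in>A. gp_monom (of_real (exp (s j))) (e j)) = gp_monom (of_real (exp (sum s A))) (sum e A)"
    if "finite A" for A and s e :: "'a \<Rightarrow> real"
    using that
  proof (induction A)
    case empty
    then show ?case by (simp add: one_gpuiseux_def)
  next
    case (insert x A)
    then show ?case by (simp add: gp_monom_mult exp_add)
  qed
  then show ?thesis
    by (simp add: gp_mon_def powi inner_vec_def lattice_real_def)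
qed

section \<open>Balanced families\<close>

text \<open>Generic in the ring, because both complex directions and vectors of series are paired
  with exponents.\<close>

definition lat_pair :: "int ^ 'r \<Rightarrow> 'a::ring_1 ^ 'r \<Rightarrow> 'a" where
  "lat_pair v z = (\<Sum>j\<in>UNIV. of_int (v $ j) * z $ j)"

text \<open>For the terms of W at a point this is the critical point equation in
  coordinates.\<close>

definition gp_balanced :: "nat \<Rightarrow> (nat \<Rightarrow> int ^ 'r) \<Rightarrow> (nat \<Rightarrow> gpuiseux) \<Rightarrow> bool" where
  "gp_balanced n v k \<longleftrightarrow> (\<forall>j. (\<Sum>i=1..n. of_int (v i $ j) * k i) = 0)"

lemma gp_balanced_diff:
  "gp_balanced n v k \<Longrightarrow> gp_balanced n v l \<Longrightarrow> gp_balanced n v (\<lambda>i. k i - l i)"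
  by (simp add: gp_balanced_def right_diff_distrib sum_subtractf)

lemma lat_pair_of_real:
  "lat_pair v (\<chi> j. of_real (x $ j)) = (of_real (lattice_real v \<bullet> x) :: complex)"
  by (simp add: lat_pair_def lattice_real_def inner_vec_def)

lemma lat_pair_cnj: "lat_pair v (\<chi> j. cnj (x $ j)) = cnj (lat_pair v x)"
  by (simp add: lat_pair_def)

lemma gp_O_lat_pair: "(\<And>j. z $ j \<in> gp_O \<mu>) \<Longrightarrow> lat_pair v z \<in> gp_O \<mu>"
  by (simp add: lat_pair_def gp_O_sum gp_O_of_int_mult)

lemma gp_coeff_lat_pair: "gp_coeff (lat_pair v z) x = lat_pair v (\<chi> j. gp_coeff (z $ j) x)"
  by (simp add: lat_pair_def)

text \<open>Extends the equation from coordinate directions to complex ones, one coefficient at a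
  time, so that conjugated coefficient vectors and values of Q-linear maps can serve as test
  directions.\<close>

lemma gp_balanced_pair:
  assumes "gp_balanced n v k"
  shows "(\<Sum>i=1..n. gp_monom (lat_pair (v i) u) 0 * k i) = 0"
proof (rule gp_eqI)
  fix x
  have "gp_coeff (\<Sum>i=1..n. gp_monom (lat_pair (v i) u) 0 * k i) x =
        (\<Sum>i=1..n. lat_pair (v i) u * gp_coeff (k i) x)"
    by simp
  also have "\<dots> = (\<Sum>i=1..n. \<Sum>j\<in>UNIV. u $ j * (of_int (v i $ j) * gp_coeff (k i) x))"
    by (simp add: lat_pair_def sum_distrib_left sum_distrib_right mult_ac)
  also have "\<dots> = (\<Sum>j\<in>UNIV. u $ j * gp_coeff (\<Sum>i=1..n. of_int (v i $ j) * k i) x)"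
    by (subst sum.swap) (simp add: sum_distrib_left)
  also have "\<dots> = gp_coeff 0 x" using assms by (simp add: gp_balanced_def del: gp_coeff_sum)
  finally show "gp_coeff (\<Sum>i=1..n. gp_monom (lat_pair (v i) u) 0 * k i) x = gp_coeff 0 x" .
qed

text \<open>A linear functional below the bound at all exponents would stay below it on their hull,
  which contains a ball about 0. The case \<open>x = 0\<close> also records that there is at least
  one exponent.\<close>

lemma complete_coercive:
  assumes "complete_exponents n v"
  obtains \<epsilon> where "\<epsilon> > 0" "\<And>x. \<exists>i\<in>{1..n}. \<epsilon> * norm x \<le> lattice_real (v i) \<bullet> x"
proof -
  let ?V = "(\<lambda>i. lattice_real (v i)) ` {1..n}"
  obtain e where e: "e > 0" "ball 0 e \<subseteq> convex hull ?V"
    using assms unfolding complete_exponents_def mem_interior by blast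
  show ?thesis
  proof
    show "e / 2 > 0" using e by simp
    fix x
    show "\<exists>i\<in>{1..n}. e / 2 * norm x \<le> lattice_real (v i) \<bullet> x"
    proof (rule ccontr)
      assume neg: "\<not> (\<exists>i\<in>{1..n}. e / 2 * norm x \<le> lattice_real (v i) \<bullet> x)"
      \<comment> \<open>The factor 1/2 keeps \<open>y\<close> inside the open ball; for
        \<open>x = 0\<close> division by zero gives \<open>y = 0\<close>, which also lies in the
        hull.\<close>
      define y where "y = (e / 2 / norm x) *\<^sub>R x"
      have "y \<in> ball 0 e" using e by (auto simp: y_def)
      then have "y \<in> convex hull ?V" using e by blast
      moreover have "?V \<subseteq> {z. x \<bullet> z < e / 2 * norm x}"
        using neg by (auto simp: not_le inner_commute)
      then have "convex hull ?V \<subseteq> {z. x \<bullet> z < e / 2 * norm x}"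
        by (intro hull_minimal convex_halfspace_lt)
      ultimately have "x \<bullet> y < e / 2 * norm x" by auto
      moreover have "x \<bullet> y = e / 2 * norm x"
        by (cases "x = 0") (auto simp: y_def dot_square_norm power2_eq_square)
      ultimately show False by simp
    qed
  qed
qed

lemma complete_separates:
  assumes "complete_exponents n v" "\<And>i. i \<in> {1..n} \<Longrightarrow> lattice_real (v i) \<bullet> x = 0"
  shows "x = 0"
proof -
  obtain \<epsilon> where "\<epsilon> > 0" "\<And>x. \<exists>i\<in>{1..n}. \<epsilon> * norm x \<le> lattice_real (v i) \<bullet> x"
    using complete_coercive[OF assms(1)] by blast
  with assms(2) have "\<epsilon> * norm x \<le> 0" by metis
  with \<open>\<epsilon> > 0\<close> show ?thesis by (simp add: mult_le_0_iff)
qed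

lemma complete_separates_complex:
  fixes u :: "complex ^ 'r"
  assumes "complete_exponents n v" "\<And>i. i \<in> {1..n} \<Longrightarrow> lat_pair (v i) u = 0"
  shows "u = 0"
proof -
  have "(\<chi> j. Re (u $ j)) = 0"
  proof (rule complete_separates[OF assms(1)])
    fix i assume "i \<in> {1..n}"
    then have "Re (lat_pair (v i) u) = 0" using assms(2) by simp
    then show "lattice_real (v i) \<bullet> (\<chi> j. Re (u $ j)) = 0"
      by (simp add: lat_pair_def lattice_real_def inner_vec_def)
  qed
  moreover have "(\<chi> j. Im (u $ j)) = 0"
  proof (rule complete_separates[OF assms(1)])
    fix i assume "i \<in> {1..n}"
    then have "Im (lat_pair (v i) u) = 0" using assms(2) by simp
    then show "lattice_real (v i) \<bullet> (\<chi> j. Im (u $ j)) = 0"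
      by (simp add: lat_pair_def lattice_real_def inner_vec_def)
  qed
  ultimately show ?thesis by (simp add: vec_eq_iff complex_eq_iff)
qed

text \<open>If some pairing were nonzero, the nonzero terms would add up to a positive series
  although the whole sum vanishes. So \<open>u\<close> annihilates all exponents, and these
  span.\<close>

lemma gp_balanced_positive:
  fixes u :: "complex ^ 'r"
  assumes "complete_exponents n v" "gp_balanced n v k"
    and pos: "\<And>i. i \<in> {1..n} \<Longrightarrow> lat_pair (v i) u \<noteq> 0 \<Longrightarrow> gp_monom (lat_pair (v i) u) 0 * k i \<in> gp_pos"
  shows "u = 0"
proof (rule complete_separates_complex[OF assms(1)], rule ccontr)
  define J where "J = {i\<in>{1..n}. lat_pair (v i) u \<noteq> 0}"
  fix i assume "i \<in> {1..n}" "lat_pair (v i) u \<noteq> 0"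
  then have "J \<noteq> {}" by (auto simp: J_def)
  then have "(\<Sum>i\<in>J. gp_monom (lat_pair (v i) u) 0 * k i) \<in> gp_pos"
    using pos by (intro gp_pos_sum) (auto simp: J_def)
  also have "(\<Sum>i\<in>J. gp_monom (lat_pair (v i) u) 0 * k i) = (\<Sum>i=1..n. gp_monom (lat_pair (v i) u) 0 * k i)"
    by (rule sum.mono_neutral_left) (auto simp: J_def)
  also have "\<dots> = 0" by (rule gp_balanced_pair[OF assms(2)])
  finally show False by (simp add: gp_pos_def)
qed

lemma gp_vec_lowest:
  fixes z :: "gpuiseux ^ 'r"
  assumes "z \<noteq> 0"
  obtains \<nu> where "\<And>l. z $ l \<in> gp_O \<nu>" "(\<chi> l. gp_coeff (z $ l) \<nu>) \<noteq> 0"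
proof -
  define \<nu> where "\<nu> = Min ((\<lambda>l. gp_val (z $ l)) ` {l. z $ l \<noteq> 0})"
  have "\<nu> \<in> (\<lambda>l. gp_val (z $ l)) ` {l. z $ l \<noteq> 0}"
    unfolding \<nu>_def by (rule Min_in) (use assms in \<open>auto simp: vec_eq_iff\<close>)
  then obtain l where l: "z $ l \<noteq> 0" "\<nu> = gp_val (z $ l)" by auto
  show ?thesis
  proof
    show "(\<chi> l. gp_coeff (z $ l) \<nu>) \<noteq> 0"
      using gp_val_Least[OF l(1)] l(2) by (auto simp: vec_eq_iff)
    fix k
    show "z $ k \<in> gp_O \<nu>"
    proof (cases "z $ k = 0")
      case False
      then have "\<nu> \<le> gp_val (z $ k)" unfolding \<nu>_def by (intro Min_le) auto
      then show ?thesis using gp_O_val gp_O_mono by blast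
    qed simp
  qed
qed

text \<open>
  Weighted least squares are bounded independently of the positive weights: otherwise test the
  equation against the conjugate of the lowest coefficient vector of \<open>z\<close>.
\<close>

lemma gp_balanced_bound:
  fixes z :: "gpuiseux ^ 'r"
  assumes v: "complete_exponents n v" and m: "\<And>i. i \<in> {1..n} \<Longrightarrow> m i \<in> gp_pos"
    and \<delta>: "\<And>i. i \<in> {1..n} \<Longrightarrow> \<delta> i \<in> gp_O \<mu>"
    and bal: "gp_balanced n v (\<lambda>i. m i * (lat_pair (v i) z - \<delta> i))"
  shows "z $ j \<in> gp_O \<mu>"
proof (rule ccontr)
  assume j: "z $ j \<notin> gp_O \<mu>"
  then have "z \<noteq> 0" by auto
  then obtain \<nu> where z: "\<And>l. z $ l \<in> gp_O \<nu>" and bnz: "(\<chi> l. gp_coeff (z $ l) \<nu>) \<noteq> 0"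
    using gp_vec_lowest by blast
  have "\<nu> < \<mu>" using z[of j] j gp_O_mono[of "z $ j" \<nu> \<mu>] by force
  define b where "b = (\<chi> l. gp_coeff (z $ l) \<nu>)"
  have "(\<chi> l. cnj (b $ l)) = 0"
  proof (rule gp_balanced_positive[OF v bal])
    fix i assume i: "i \<in> {1..n}" and "lat_pair (v i) (\<chi> l. cnj (b $ l)) \<noteq> 0"
    then have nz: "lat_pair (v i) b \<noteq> 0" by (simp add: lat_pair_cnj)
    \<comment> \<open>The \<open>\<delta> i\<close> have no coefficient at
      \<open>\<nu> < \<mu>\<close>, so the coefficient of \<open>q\<close> there is the pairing with
      \<open>b\<close>; against its conjugate it yields a squared modulus.\<close>
    define q where "q = lat_pair (v i) z - \<delta> i"
    have q: "q \<in> gp_O \<nu>" "gp_coeff q \<nu> = lat_pair (v i) b"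
      using \<delta>[OF i] \<open>\<nu> < \<mu>\<close> z gp_O_mono[of "\<delta> i" \<mu> \<nu>]
      by (auto simp: q_def b_def gp_coeff_lat_pair gp_O_def[of \<mu>] intro!: gp_O_diff gp_O_lat_pair)
    have "gp_monom (cnj (lat_pair (v i) b)) 0 * (m i * q) \<in> gp_pos"
    proof (rule gp_posI(1))
      show "gp_monom (cnj (lat_pair (v i) b)) 0 * (m i * q) \<in> gp_O (gp_val (m i) + \<nu>)"
        by (intro gp_O_const_mult gp_O_mult gp_O_val q)
      have "gp_coeff (gp_monom (cnj (lat_pair (v i) b)) 0 * (m i * q)) (gp_val (m i) + \<nu>)
          = gp_lead (m i) * (lat_pair (v i) b * cnj (lat_pair (v i) b))"
        by (simp add: gp_coeff_mult_O[OF gp_O_val q(1)] q gp_lead_def)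
      also have "\<dots> = of_real (Re (gp_lead (m i)) * (cmod (lat_pair (v i) b))\<^sup>2)"
        by (simp only: of_real_mult gp_posD(2)[OF m[OF i]] complex_norm_square)
      finally show "gp_coeff (gp_monom (cnj (lat_pair (v i) b)) 0 * (m i * q)) (gp_val (m i) + \<nu>)
          = of_real (Re (gp_lead (m i)) * (cmod (lat_pair (v i) b))\<^sup>2)" .
      show "Re (gp_lead (m i)) * (cmod (lat_pair (v i) b))\<^sup>2 > 0"
        using gp_posD(3)[OF m[OF i]] nz by simp
    qed
    then show "gp_monom (lat_pair (v i) (\<chi> l. cnj (b $ l))) 0 * (m i * (lat_pair (v i) z - \<delta> i)) \<in> gp_pos"
      by (simp add: lat_pair_cnj q_def)
  qed
  then show False using bnz by (simp add: b_def vec_eq_iff)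
qed

section \<open>Uniqueness\<close>

text \<open>A homomorphism is determined by its values on a lattice basis; this passes to
  coordinates, where the expansions of characters apply.\<close>

lemma torus_points_mon:
  fixes p :: "int ^ 'r \<Rightarrow> gpuiseux"
  assumes p: "p \<in> torus_points gp_pos"
  shows "p v = gp_mon (\<chi> j. p (axis j 1)) v"
proof -
  have add: "p (v + w) = p v * p w" and nz: "p v \<noteq> 0" for v w
    using p by (auto simp: torus_points_def gp_pos_def)
  have zero: "p 0 = 1" using add[of 0 0] nz[of 0] by simp
  have minus: "p (- v) = inverse (p v)" for v
    using add[of v "- v"] zero by (simp add: inverse_unique)
  have nat: "p (of_nat k *s v) = p v ^ k" for k v
  proof (induction k)
    case (Suc k)
    have "of_nat (Suc k) *s v = v + of_nat k *s v" by (simp add: vec_eq_iff algebra_simps)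
    then show ?case by (simp only: add Suc power_Suc)
  qed (simp add: zero)
  have int: "p (k *s v) = p v powi k" for k v
  proof (cases "k \<ge> 0")
    case True
    then show ?thesis using nat[of "nat k" v] by (simp add: power_int_def)
  next
    case False
    have "k *s v = - (of_nat (nat (- k)) *s v)" using False by (simp add: vec_eq_iff)
    then show ?thesis using False by (simp only: minus nat) (simp add: power_int_def power_inverse)
  qed
  have sum: "p (\<Sum>j\<in>A. f j) = (\<Prod>j\<in>A. p (f j))" for A and f :: "'r \<Rightarrow> int ^ 'r"
    by (induction A rule: infinite_finite_induct) (simp_all add: add zero)
  have "p v = p (\<Sum>j\<in>UNIV. v $ j *s axis j 1)" by (simp only: basis_expansion)
  then show ?thesis by (simp add: sum int gp_mon_def)
qed

lemma positive_critical_point_iff: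
  "positive_critical_point n \<gamma> v p \<longleftrightarrow>
     p \<in> torus_points gp_pos \<and> gp_balanced n v (\<lambda>i. \<gamma> i * p (v i))"
proof -
  have expand: "(\<Sum>i=1..n. \<gamma> i * of_int (lattice_pairing (v i) u) * p (v i)) =
      (\<Sum>j\<in>UNIV. of_int (u $ j) * (\<Sum>i=1..n. of_int (v i $ j) * (\<gamma> i * p (v i))))" for u
  proof -
    have "(\<Sum>i=1..n. \<gamma> i * of_int (lattice_pairing (v i) u) * p (v i)) =
        (\<Sum>i=1..n. \<Sum>j\<in>UNIV. of_int (u $ j) * (of_int (v i $ j) * (\<gamma> i * p (v i))))"
      by (simp add: lattice_pairing_def sum_distrib_left sum_distrib_right mult_ac)
    then show ?thesis by (simp add: sum.swap[of _ UNIV] sum_distrib_left)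
  qed
  have axis: "(\<Sum>i=1..n. of_int (v i $ j) * (\<gamma> i * p (v i))) =
      (\<Sum>i=1..n. \<gamma> i * of_int (lattice_pairing (v i) (axis j 1)) * p (v i))" for j
    by (simp add: lattice_pairing_def axis_def if_distrib[of "(*) _"] mult_ac cong: if_cong)
  have "(\<forall>u. (\<Sum>i=1..n. \<gamma> i * of_int (lattice_pairing (v i) u) * p (v i)) = 0) \<longleftrightarrow>
      gp_balanced n v (\<lambda>i. \<gamma> i * p (v i))" (is "?L \<longleftrightarrow> ?R")
  proof
    show "?L \<Longrightarrow> ?R" unfolding gp_balanced_def axis by blast
    show "?R \<Longrightarrow> ?L" unfolding gp_balanced_def expand by simp
  qed
  then show ?thesis unfolding positive_critical_point_def by blast
qed

text \<open>Logarithms of leading coefficients pair linearly with exponents, just as valuations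
  do.\<close>

lemma gp_lead_mon:
  fixes x :: "gpuiseux ^ 'r"
  assumes x: "\<And>j. x $ j \<in> gp_pos"
  shows "gp_lead (gp_mon x v) =
    of_real (exp (lattice_real v \<bullet> (\<chi> j. ln (Re (gp_lead (x $ j))))))"
proof -
  have pow: "gp_lead (f ^ k) = gp_lead f ^ k" if "f \<noteq> 0" for f k
    using that by (induction k) (auto simp: gp_lead_mult)
  have powi: "gp_lead (f powi k) = of_real (exp (of_int k * ln (Re (gp_lead f))))"
    if f: "f \<in> gp_pos" for f k
  proof -
    have "of_real (exp (ln (Re (gp_lead f)))) = gp_lead f" using gp_posD[OF f] by simp
    moreover have "gp_lead (f powi k) = gp_lead f powi k"
      using gp_posD(1)[OF f] by (simp add: power_int_def pow gp_lead_inverse power_inverse)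
    moreover have "exp (of_int k * s) = exp s powi k" for s :: real
      by (simp add: exp_power_int)
    ultimately show ?thesis by (metis of_real_power_int)
  qed
  have "gp_lead (\<Prod>j\<in>A. x $ j powi (v $ j)) =
      of_real (exp (\<Sum>j\<in>A. of_int (v $ j) * ln (Re (gp_lead (x $ j)))))" if "finite A" for A
    using that
  proof (induction A)
    case (insert j A)
    have "x $ j powi (v $ j) \<noteq> 0" "(\<Prod>j\<in>A. x $ j powi (v $ j)) \<noteq> 0"
      using gp_posD(1)[OF gp_pos_powi[OF x]] gp_posD(1)[OF gp_pos_prod[OF gp_pos_powi[OF x]]] by auto
    with insert show ?case by (simp add: gp_lead_mult powi x exp_add)
  qed simp
  then show ?thesis by (simp add: gp_mon_def inner_vec_def lattice_real_def)
qed

section \<open>Comparison of positive series by leading terms\<close>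

lemma gp_pos_scaled_diff:
  assumes "s > 0 \<Longrightarrow> f - h \<in> gp_pos" "s < 0 \<Longrightarrow> h - f \<in> gp_pos" "s \<noteq> 0"
  shows "gp_monom (of_real s) 0 * (f - h) \<in> gp_pos"
proof (cases "s > 0")
  case False
  then have "gp_monom (of_real (- s)) 0 * (h - f) \<in> gp_pos" using assms by (intro gp_pos_scale) auto
  also have "gp_monom (of_real (- s)) 0 * (h - f) = gp_monom (of_real s) 0 * (f - h)"
    by (rule gp_eqI) (simp add: right_diff_distrib)
  finally show ?thesis .
qed (use assms gp_pos_scale in auto)

text \<open>As \<open>t\<close> behaves like a small positive quantity, the smaller valuation
  belongs to the larger series.\<close>

lemma gp_pos_diff_val: "f \<in> gp_pos \<Longrightarrow> gp_val f < gp_val g \<Longrightarrow> f - g \<in> gp_pos"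
  using gp_pos_add_dominated[of f "- g"] by (simp add: gp_val_def)

lemma gp_pos_diff_eq_val:
  assumes "f \<in> gp_pos" "g \<in> gp_pos" "gp_val f = gp_val g" "Re (gp_lead g) < Re (gp_lead f)"
  shows "f - g \<in> gp_pos"
proof (rule gp_posI(1))
  show "f - g \<in> gp_O (gp_val f)"
    using assms gp_O_val[of f] gp_O_val[of g] by (auto intro!: gp_O_diff)
  show "gp_coeff (f - g) (gp_val f) = of_real (Re (gp_lead f) - Re (gp_lead g))"
    using assms gp_posD(2)[of f] gp_posD(2)[of g] by (simp add: gp_lead_def)
qed (use assms in simp)

lemma gp_unitE:
  assumes "gp_val f = 0" "gp_lead f = 1"
  obtains \<mu> where "\<mu> > 0" "f - 1 \<in> gp_O \<mu>"
proof (cases "f - 1 = 0")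
  case False
  have "gp_coeff (f - 1) x = 0" if "x \<le> 0" for x
    using assms that gp_coeff_below_val[of x f] by (cases "x = 0") (auto simp: gp_coeff_one gp_lead_def)
  then have "gp_val (f - 1) > 0" using gp_val_Least[OF False] by (meson not_le)
  then show ?thesis using that gp_O_val by blast
qed (use that[of 1] in auto)

text \<open>Valuations are matched first, then leading coefficients, so the coordinates of
  \<open>q\<close> are those of \<open>p\<close> times \<open>1 + z\<close> with \<open>z\<close> of
  positive order. Subtracting the critical equations bounds \<open>z\<close> by its own quadratic
  error, which forces \<open>z = 0\<close>.\<close>

lemma positive_critical_point_unique:
  fixes v :: "nat \<Rightarrow> int ^ 'r"
  assumes v: "complete_exponents n v" and \<gamma>: "\<And>i. i \<in> {1..n} \<Longrightarrow> \<gamma> i \<in> gp_pos"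
    and p: "positive_critical_point n \<gamma> v p" and q: "positive_critical_point n \<gamma> v q"
  shows "p = q"
proof -
  have pt: "p \<in> torus_points gp_pos" and pb: "gp_balanced n v (\<lambda>i. \<gamma> i * p (v i))"
    and qt: "q \<in> torus_points gp_pos" and qb: "gp_balanced n v (\<lambda>i. \<gamma> i * q (v i))"
    using p q by (auto simp: positive_critical_point_iff)
  define P Q where "P = (\<chi> j. p (axis j 1))" and "Q = (\<chi> j. q (axis j 1))"
  have pP: "p w = gp_mon P w" and qQ: "q w = gp_mon Q w" for w
    unfolding P_def Q_def by (rule torus_points_mon[OF pt], rule torus_points_mon[OF qt])
  have pp: "p w \<in> gp_pos" "q w \<in> gp_pos" for w using pt qt by (auto simp: torus_points_def)
  then have PQ: "P $ j \<in> gp_pos" "Q $ j \<in> gp_pos" for j by (auto simp: P_def Q_def)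
  have fh: "\<gamma> i * p (v i) \<in> gp_pos" "\<gamma> i * q (v i) \<in> gp_pos" if "i \<in> {1..n}" for i
    using \<gamma>[OF that] pp by (auto intro: gp_pos_mult)
  have bal: "gp_balanced n v (\<lambda>i. \<gamma> i * p (v i) - \<gamma> i * q (v i))"
    using pb qb by (rule gp_balanced_diff)
  have val: "gp_val (\<gamma> i * p (v i)) = gp_val (\<gamma> i) + lattice_real (v i) \<bullet> torus_val p"
    "gp_val (\<gamma> i * q (v i)) = gp_val (\<gamma> i) + lattice_real (v i) \<bullet> torus_val q"
    if "i \<in> {1..n}" for i
    using gp_posD(1)[OF \<gamma>[OF that]] gp_posD(1)[OF pp(1)] gp_posD(1)[OF pp(2)]
    by (auto simp: gp_val_mult torus_val pt qt)
  \<comment> \<open>The order of the difference is reversed: a positive pairing then gives the term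
    at \<open>p\<close> the lower valuation, hence makes it the larger one. For leading coefficients
    \<open>a - b\<close> has the natural sign.\<close>
  have "(\<chi> j. of_real ((torus_val q - torus_val p) $ j)) = (0 :: complex ^ 'r)"
  proof (rule gp_balanced_positive[OF v bal], unfold lat_pair_of_real)
    fix i assume i: "i \<in> {1..n}"
      and nz: "complex_of_real (lattice_real (v i) \<bullet> (torus_val q - torus_val p)) \<noteq> 0"
    show "gp_monom (of_real (lattice_real (v i) \<bullet> (torus_val q - torus_val p))) 0 *
        (\<gamma> i * p (v i) - \<gamma> i * q (v i)) \<in> gp_pos"
      using nz fh[OF i] val[OF i]
      by (intro gp_pos_scaled_diff gp_pos_diff_val) (auto simp: inner_diff_right)
  qed
  then have eqv: "torus_val p = torus_val q" by (simp add: vec_eq_iff)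
  define a b where "a = (\<chi> j. ln (Re (gp_lead (P $ j))))" and "b = (\<chi> j. ln (Re (gp_lead (Q $ j))))"
  have lead: "Re (gp_lead (\<gamma> i * p (v i))) = Re (gp_lead (\<gamma> i)) * exp (lattice_real (v i) \<bullet> a)"
    "Re (gp_lead (\<gamma> i * q (v i))) = Re (gp_lead (\<gamma> i)) * exp (lattice_real (v i) \<bullet> b)"
    if "i \<in> {1..n}" for i
    using gp_posD(1)[OF \<gamma>[OF that]] gp_posD(1)[OF pp(1)] gp_posD(1)[OF pp(2)]
    by (auto simp: gp_lead_mult pP qQ gp_lead_mon PQ a_def b_def)
  have "(\<chi> j. of_real ((a - b) $ j)) = (0 :: complex ^ 'r)"
  proof (rule gp_balanced_positive[OF v bal], unfold lat_pair_of_real)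
    fix i assume i: "i \<in> {1..n}" and nz: "complex_of_real (lattice_real (v i) \<bullet> (a - b)) \<noteq> 0"
    show "gp_monom (of_real (lattice_real (v i) \<bullet> (a - b))) 0 *
        (\<gamma> i * p (v i) - \<gamma> i * q (v i)) \<in> gp_pos"
      using nz fh[OF i] val[OF i] eqv lead[OF i] gp_posD(3)[OF \<gamma>[OF i]]
      by (intro gp_pos_scaled_diff gp_pos_diff_eq_val) (auto simp: inner_diff_right)
  qed
  then have ab: "a = b" by (simp add: vec_eq_iff)
  define z where "z = (\<chi> j. Q $ j / P $ j - 1)"
  have Pnz: "P $ j \<noteq> 0" for j using PQ gp_posD by blast
  have Qnz: "Q $ j \<noteq> 0" for j using PQ gp_posD by blast
  have "\<exists>\<mu>>0. z $ j \<in> gp_O \<mu>" for j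
  proof -
    have "gp_val (P $ j) = gp_val (Q $ j)"
      by (simp add: P_def Q_def torus_val pt qt eqv)
    then have 1: "gp_val (Q $ j / P $ j) = 0"
      using Pnz Qnz by (simp add: divide_inverse gp_val_mult gp_val_inverse)
    have "ln (Re (gp_lead (P $ j))) = ln (Re (gp_lead (Q $ j)))"
      using ab by (simp add: a_def b_def vec_eq_iff)
    then have "Re (gp_lead (P $ j)) = Re (gp_lead (Q $ j))"
      using gp_posD(3)[OF PQ(1)] gp_posD(3)[OF PQ(2)] by simp
    then have "gp_lead (P $ j) = gp_lead (Q $ j)"
      using gp_posD(2)[OF PQ(1)[of j]] gp_posD(2)[OF PQ(2)[of j]] by metis
    then have 2: "gp_lead (Q $ j / P $ j) = 1"
      using Pnz Qnz gp_lead_nonzero[OF Qnz[of j]]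
      by (simp add: divide_inverse gp_lead_mult gp_lead_inverse)
    from gp_unitE[OF 1 2] show ?thesis by (metis z_def vec_lambda_beta)
  qed
  then obtain \<mu> where \<mu>: "\<And>j. \<mu> j > 0" "\<And>j. z $ j \<in> gp_O (\<mu> j)" by metis
  define \<nu> where "\<nu> = Min (range \<mu>)"
  have \<nu>: "\<nu> > 0" unfolding \<nu>_def using \<mu>(1) by (subst Min_gr_iff) auto
  have zO: "z $ j \<in> gp_O \<nu>" for j
    using \<mu>(2)[of j] by (rule gp_O_mono) (simp add: \<nu>_def)
  have Qz: "Q = (\<chi> j. P $ j * (\<chi> l. 1 + z $ l) $ j)"
    using Pnz by (simp add: z_def vec_eq_iff)
  have qpz: "q w = p w * gp_mon (\<chi> l. 1 + z $ l) w" for w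
    unfolding qQ pP by (subst Qz) (rule gp_mon_mult)
  have double: "z $ j \<in> gp_O (2 * \<kappa>)" if z: "\<And>j. z $ j \<in> gp_O \<kappa>" and \<kappa>: "\<kappa> > 0" for \<kappa> j
  proof (rule gp_balanced_bound[OF v])
    \<comment> \<open>The linearisation error, chosen so that
      \<open>p (v i) * (lat_pair (v i) z - \<epsilon> i)\<close> equals
      \<open>q (v i) - p (v i)\<close>.\<close>
    define \<epsilon> where "\<epsilon> i = 1 + lat_pair (v i) z - gp_mon (\<chi> l. 1 + z $ l) (v i)" for i
    have "- \<epsilon> i \<in> gp_O (2 * \<kappa>)" for i
      using gp_mon_unit[OF z \<kappa>, of "v i"] by (simp add: \<epsilon>_def lat_pair_def algebra_simps)
    then show "\<epsilon> i \<in> gp_O (2 * \<kappa>)" for i using gp_O_uminus by fastforce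
    have "gp_balanced n v (\<lambda>i. \<gamma> i * q (v i) - \<gamma> i * p (v i))"
      using qb pb by (rule gp_balanced_diff)
    also have "(\<lambda>i. \<gamma> i * q (v i) - \<gamma> i * p (v i)) = (\<lambda>i. \<gamma> i * p (v i) * (lat_pair (v i) z - \<epsilon> i))"
      by (auto simp: qpz \<epsilon>_def algebra_simps)
    finally show "gp_balanced n v (\<lambda>i. \<gamma> i * p (v i) * (lat_pair (v i) z - \<epsilon> i))" .
  qed (use fh in auto)
  \<comment> \<open>Each doubling gains at least one further \<open>\<nu>\<close>, enough to exceed
    every order.\<close>
  have "z $ j \<in> gp_O (\<nu> + of_nat k * \<nu>)" for j k
  proof (induction k arbitrary: j)
    case (Suc k)
    have "z $ j \<in> gp_O (2 * (\<nu> + of_nat k * \<nu>))"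
      using \<nu> by (intro double Suc) (simp add: add_pos_nonneg)
    then show ?case by (rule gp_O_mono) (use \<nu> in \<open>simp add: algebra_simps\<close>)
  qed (use zO in simp)
  then have "z $ j = 0" for j using gp_O_all_zero[OF \<nu>] by blast
  then have "q w = p w" for w
    using qpz[of w] by (simp add: gp_mon_def)
  then show ?thesis by auto
qed

section \<open>Rationality\<close>

text \<open>Over the rationals \<open>1\<close> and an irrational \<open>x\<close> are independent,
  so values prescribed on both extend to a Q-linear map of the reals.\<close>

lemma rat_linear_separating:
  assumes "x \<notin> \<rat>"
  obtains \<rho> :: "real \<Rightarrow> real"
  where "\<And>a b. \<rho> (a + b) = \<rho> a + \<rho> b" "\<And>q a. q \<in> \<rat> \<Longrightarrow> \<rho> (q * a) = q * \<rho> a" "\<rho> 1 = 0" "\<rho> x = 1"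
proof -
  interpret Q: vector_space "\<lambda>(q::rat) (x::real). of_rat q * x"
    by unfold_locales (auto simp: algebra_simps of_rat_add of_rat_mult)
  interpret QQ: vector_space_pair "\<lambda>(q::rat) (x::real). of_rat q * x" "\<lambda>(q::rat) (x::real). of_rat q * x"
    by unfold_locales
  have "x \<notin> Q.span {1}"
    using assms by (auto simp: Q.span_singleton)
  then have "Q.independent {x, 1}"
    by (auto simp: Q.independent_insert)
  then obtain \<rho> where lin: "Vector_Spaces.linear (\<lambda>(q::rat) (x::real). of_rat q * x) (\<lambda>(q::rat) (x::real). of_rat q * x) \<rho>"
    and \<rho>: "\<forall>y\<in>{x, 1}. \<rho> y = (if y = x then 1 else 0)"
    using QQ.linear_independent_extend[of "{x, 1}" "\<lambda>y. if y = x then 1 else 0"] by blast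
  have "\<rho> (a + b) = \<rho> a + \<rho> b" "\<rho> (of_rat q * a) = of_rat q * \<rho> a" for a b q
    using lin by (auto simp: Vector_Spaces.linear_iff)
  moreover have "\<rho> x = 1" "\<rho> 1 = 0" using \<rho> assms by auto
  ultimately show ?thesis by (intro that[of \<rho>]) (auto elim!: Rats_cases)
qed

lemma positive_critical_point_val_rational:
  fixes v :: "nat \<Rightarrow> int ^ 'r"
  assumes v: "complete_exponents n v" and \<gamma>: "\<And>i. i \<in> {1..n} \<Longrightarrow> \<gamma> i \<in> gp_pos"
    and rat: "\<And>i. i \<in> {1..n} \<Longrightarrow> gp_val (\<gamma> i) \<in> \<rat>"
    and p: "positive_critical_point n \<gamma> v p"
  shows "torus_val p \<in> rational_points"
proof -
  define d where "d = torus_val p"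
  have pt: "p \<in> torus_points gp_pos" and bal: "gp_balanced n v (\<lambda>i. \<gamma> i * p (v i))"
    using p by (auto simp: positive_critical_point_iff)
  have pp: "p w \<in> gp_pos" for w using pt by (auto simp: torus_points_def)
  define m where "m i = \<gamma> i * p (v i)" for i
  have m: "m i \<in> gp_pos" "gp_val (m i) = gp_val (\<gamma> i) + lattice_real (v i) \<bullet> d" if "i \<in> {1..n}" for i
    using that \<gamma>[of i] pp[of "v i"] gp_posD(1)[of "\<gamma> i"] gp_posD(1)[of "p (v i)"]
    by (auto simp: m_def gp_pos_mult gp_val_mult torus_val[OF pt] d_def)
  have "d $ j \<in> \<rat>" for j
  proof (rule ccontr)
    assume "d $ j \<notin> \<rat>"
    then obtain \<rho> :: "real \<Rightarrow> real" where \<rho>: "\<And>a b. \<rho> (a + b) = \<rho> a + \<rho> b"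
      "\<And>q a. q \<in> \<rat> \<Longrightarrow> \<rho> (q * a) = q * \<rho> a" "\<rho> 1 = 0" "\<rho> (d $ j) = 1"
      using rat_linear_separating by blast
    have \<rho>rat: "\<rho> q = 0" if "q \<in> \<rat>" for q using \<rho>(2)[OF that, of 1] \<rho>(3) by simp
    have \<rho>sum: "\<rho> (sum f A) = (\<Sum>l\<in>A. \<rho> (f l))" for A and f :: "'r \<Rightarrow> real"
      by (induction A rule: infinite_finite_induct) (auto simp: \<rho> \<rho>rat)
    \<comment> \<open>Since \<open>\<rho>\<close> kills the rational valuations of the
      \<open>\<gamma> i\<close>, pairing with \<open>u\<close> returns \<open>\<rho>\<close> of the
      full valuation of the \<open>i\<close>-th term.\<close>
    define u where "u = (\<chi> l. complex_of_real ((\<chi> l. \<rho> (d $ l)) $ l))"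
    have pair: "lat_pair (v i) u = of_real (\<rho> (gp_val (m i)))" if "i \<in> {1..n}" for i
      unfolding u_def lat_pair_of_real m(2)[OF that] \<rho>(1) \<rho>rat[OF rat[OF that]]
      by (simp add: inner_vec_def lattice_real_def \<rho>sum \<rho>(2))
    define J where "J = {i\<in>{1..n}. \<rho> (gp_val (m i)) \<noteq> 0}"
    have "u $ j \<noteq> 0" by (simp add: u_def \<rho>)
    then have "u \<noteq> 0" by auto
    then have J: "finite J" "J \<noteq> {}"
      using complete_separates_complex[OF v, of u] pair by (auto simp: J_def)
    define c where "c = Min ((\<lambda>i. gp_val (m i)) ` J)"
    have "c \<in> (\<lambda>i. gp_val (m i)) ` J" unfolding c_def using J by (intro Min_in) auto
    then obtain k where k: "k \<in> J" "gp_val (m k) = c" by auto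
    have c: "c \<le> gp_val (m i)" if "i \<in> J" for i using that J by (auto simp: c_def)
    \<comment> \<open>At the lowest exponent \<open>c\<close> among terms of nonzero weight, a term
      either contributes nothing or has valuation exactly \<open>c\<close>. So all contributing
      weights equal \<open>\<rho> c\<close>, which is nonzero because \<open>k\<close> lies in
      \<open>J\<close>.\<close>
    have coeff: "\<rho> (gp_val (m i)) * gp_coeff (m i) c = \<rho> c * gp_coeff (m i) c"
      "Re (gp_coeff (m i) c) \<ge> 0" if "i \<in> J" for i
    proof -
      have "gp_coeff (m i) c = 0 \<or> gp_val (m i) = c"
        using c[OF that] gp_coeff_below_val[of c "m i"] by linarith
      then show "\<rho> (gp_val (m i)) * gp_coeff (m i) c = \<rho> c * gp_coeff (m i) c"
        "Re (gp_coeff (m i) c) \<ge> 0"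
        using gp_posD(3)[OF m(1)[of i]] that by (auto simp: J_def gp_lead_def)
    qed
    have "0 = gp_coeff (\<Sum>i=1..n. gp_monom (lat_pair (v i) u) 0 * m i) c"
      using gp_balanced_pair[OF bal, of u] by (simp add: m_def del: gp_coeff_sum)
    also have "\<dots> = (\<Sum>i=1..n. \<rho> (gp_val (m i)) * gp_coeff (m i) c)"
      by (simp add: pair)
    also have "\<dots> = (\<Sum>i\<in>J. \<rho> (gp_val (m i)) * gp_coeff (m i) c)"
      by (rule sum.mono_neutral_right) (auto simp: J_def)
    also have "\<dots> = \<rho> c * (\<Sum>i\<in>J. gp_coeff (m i) c)"
      by (simp add: coeff sum_distrib_left)
    finally have "Re (\<Sum>i\<in>J. gp_coeff (m i) c) = 0" using k by (auto simp: J_def)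
    moreover have "(\<Sum>i\<in>J. Re (gp_coeff (m i) c)) > 0"
      using J k coeff(2) gp_posD(3)[OF m(1)[of k]]
      by (intro sum_pos2[of J k]) (auto simp: J_def gp_lead_def)
    ultimately show False by simp
  qed
  then show ?thesis by (simp add: rational_points_def d_def)
qed

section \<open>Twists by characters of the exponent group\<close>

text \<open>A field automorphism, as the factor is a character of the additive group of
  exponents.\<close>

lift_definition gp_twist :: "real \<Rightarrow> gpuiseux \<Rightarrow> gpuiseux" is
  "\<lambda>s f x. cis (2 * pi * (s * x)) * f x"
  by (simp add: left_finite_def)

lemma gp_coeff_twist: "gp_coeff (gp_twist s f) x = cis (2 * pi * (s * x)) * gp_coeff f x"
  by transfer simp

lemma gp_twist_mult: "gp_twist s (f * g) = gp_twist s f * gp_twist s g"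
proof (rule gp_eqI)
  fix x
  have "cis (2 * pi * (s * a)) * cis (2 * pi * (s * (x - a))) = cis (2 * pi * (s * x))" for a
    by (simp add: cis_mult algebra_simps)
  then have "conv_coeff (gp_coeff (gp_twist s f)) (gp_coeff (gp_twist s g)) x =
      cis (2 * pi * (s * x)) * conv_coeff (gp_coeff f) (gp_coeff g) x"
    unfolding conv_coeff_def gp_coeff_twist sum_distrib_left
    by (intro sum.cong) (auto simp: mult_ac)
  then show "gp_coeff (gp_twist s (f * g)) x = gp_coeff (gp_twist s f * gp_twist s g) x"
    by (simp add: gp_coeff_mult gp_coeff_twist)
qed

lemma cis_2pi_eq_1_iff: "cis (2 * pi * y) = 1 \<longleftrightarrow> y \<in> \<int>"
proof
  assume "cis (2 * pi * y) = 1"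
  then have "cos (2 * pi * y) = 1" by (metis cis.simps(1) one_complex.simps(1))
  then obtain k :: int where "2 * pi * y = of_int k * 2 * pi" using cos_one_2pi_int by blast
  then have "y = of_int k" by simp
  then show "y \<in> \<int>" by simp
qed (rule cis_multiple_2pi)

lemma gp_twist_eq_iff: "gp_twist s f = f \<longleftrightarrow> (\<forall>x. gp_coeff f x \<noteq> 0 \<longrightarrow> s * x \<in> \<int>)"
proof -
  have "gp_twist s f = f \<longleftrightarrow> (\<forall>x. cis (2 * pi * (s * x)) * gp_coeff f x = gp_coeff f x)"
    using gp_eqI[of "gp_twist s f" f] by (auto simp flip: gp_coeff_twist)
  then show ?thesis by (simp flip: cis_2pi_eq_1_iff) blast
qed

text \<open>The twist rotates the leading coefficient by a phase that is 1 exactly for integral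
  \<open>s * gp_val f\<close>; hence the valuation of the critical point has to be known to be
  rational before twisting.\<close>

lemma gp_twist_pos:
  assumes "f \<in> gp_pos" "s * gp_val f \<in> \<int>"
  shows "gp_twist s f \<in> gp_pos"
proof (rule gp_posI(1))
  show "gp_twist s f \<in> gp_O (gp_val f)"
    by (simp add: gp_O_def gp_coeff_twist gp_coeff_below_val)
  show "gp_coeff (gp_twist s f) (gp_val f) = of_real (Re (gp_lead f))"
    using assms(2) gp_posD(2)[OF assms(1)]
    by (simp add: gp_coeff_twist gp_lead_def cis_multiple_2pi)
qed (use gp_posD(3)[OF assms(1)] in auto)

section \<open>Common denominators and descent to Puiseux series\<close>

lemma common_denominator:
  assumes "finite A" "\<And>i. i \<in> A \<Longrightarrow> \<exists>l::nat>0. \<forall>x\<in>S i. real l * x \<in> \<int>"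
  obtains L :: nat where "L > 0" "\<And>i x. i \<in> A \<Longrightarrow> x \<in> S i \<Longrightarrow> real L * x \<in> \<int>"
proof -
  obtain l :: "'a \<Rightarrow> nat" where l: "\<And>i. i \<in> A \<Longrightarrow> l i > 0" "\<And>i x. i \<in> A \<Longrightarrow> x \<in> S i \<Longrightarrow> real (l i) * x \<in> \<int>"
    using assms(2) by metis
  show ?thesis
  proof
    show "prod l A > 0" using l(1) by (simp add: prod_pos)
    fix i x assume i: "i \<in> A" "x \<in> S i"
    then obtain k where "prod l A = l i * k" using assms(1) dvd_prod_eqI[of A i "l i" l] by (auto elim: dvdE)
    then have "real (prod l A) * x = of_nat k * (real (l i) * x)" by (simp add: mult_ac)
    then show "real (prod l A) * x \<in> \<int>" using l(2)[OF i] by (metis Ints_mult Ints_of_nat)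
  qed
qed

lemma Rats_denominator:
  assumes "q \<in> \<rat>"
  shows "\<exists>l::nat>0. real l * q \<in> \<int>"
proof -
  obtain a b :: int where "b > 0" "q = of_int a / of_int b" using assms by (rule Rats_cases')
  then have "real (nat b) * q = of_int a" "nat b > 0" by auto
  then show ?thesis by (metis Ints_of_int)
qed

lemma puiseux_val_rational:
  assumes "f \<in> puiseux" "f \<noteq> 0"
  shows "gp_val f \<in> \<rat>"
proof -
  obtain l :: nat where "l > 0" "real l * gp_val f \<in> \<int>"
    using assms gp_val_Least unfolding puiseux_iff by blast
  then have "gp_val f = (real l * gp_val f) / real l" "real l * gp_val f \<in> \<rat>" using Ints_subset_Rats by auto
  then show ?thesis by (metis Rats_divide Rats_of_nat)
qed

lemma positive_critical_point_puiseux: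
  fixes v :: "nat \<Rightarrow> int ^ 'r"
  assumes v: "complete_exponents n v" and \<gamma>: "\<And>i. i \<in> {1..n} \<Longrightarrow> \<gamma> i \<in> puiseux_pos"
    and p: "positive_critical_point n \<gamma> v p"
  shows "p \<in> torus_points puiseux_pos" "torus_val p \<in> rational_points"
proof -
  have \<gamma>pos: "\<gamma> i \<in> gp_pos" if "i \<in> {1..n}" for i using \<gamma>[OF that] by (simp add: puiseux_pos_def)
  show rat: "torus_val p \<in> rational_points"
    using \<gamma> by (intro positive_critical_point_val_rational[OF v \<gamma>pos _ p] puiseux_val_rational)
      (auto simp: puiseux_pos_def gp_pos_def)
  have "\<exists>l>0. \<forall>x\<in>{x. gp_coeff (\<gamma> i) x \<noteq> 0}. real l * x \<in> \<int>" if "i \<in> {1..n}" for i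
    using \<gamma>[OF that] by (simp add: puiseux_pos_def puiseux_iff)
  then obtain L1 :: nat where L1: "L1 > 0"
    "\<And>i x. i \<in> {1..n} \<Longrightarrow> x \<in> {x. gp_coeff (\<gamma> i) x \<noteq> 0} \<Longrightarrow> real L1 * x \<in> \<int>"
    using common_denominator[of "{1..n}" "\<lambda>i. {x. gp_coeff (\<gamma> i) x \<noteq> 0}"] by blast
  obtain L2 :: nat where L2: "L2 > 0" "\<And>j x. j \<in> UNIV \<Longrightarrow> x \<in> {torus_val p $ j} \<Longrightarrow> real L2 * x \<in> \<int>"
    using common_denominator[of UNIV "\<lambda>j. {torus_val p $ j}"] rat Rats_denominator
    unfolding rational_points_def by auto
  \<comment> \<open>\<open>L1\<close> clears all exponents of the coefficients, so the twist fixes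
    W; \<open>L2\<close> clears the coordinates of the valuation, so the twisted point stays
    positive.\<close>
  define s where "s = real (L1 * L2)"
  have pt: "p \<in> torus_points gp_pos" and bal: "gp_balanced n v (\<lambda>i. \<gamma> i * p (v i))"
    using p by (auto simp: positive_critical_point_iff)
  have twist\<gamma>: "gp_twist s (\<gamma> i) = \<gamma> i" if "i \<in> {1..n}" for i
    unfolding gp_twist_eq_iff
  proof safe
    fix x assume "gp_coeff (\<gamma> i) x \<noteq> 0"
    then have "of_nat L2 * (real L1 * x) \<in> \<int>" using Ints_mult[OF Ints_of_nat L1(2)[OF that]] by blast
    then show "s * x \<in> \<int>" by (simp add: s_def mult_ac)
  qed
  have sval: "s * gp_val (p w) \<in> \<int>" for w
  proof -
    have "s * gp_val (p w) = (\<Sum>j\<in>UNIV. of_int (w $ j) * (of_nat L1 * (real L2 * torus_val p $ j)))"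
      by (simp add: torus_val[OF pt] inner_vec_def lattice_real_def s_def sum_distrib_left mult_ac)
    also have "\<dots> \<in> \<int>" by (intro Ints_sum Ints_mult[OF Ints_of_int Ints_mult[OF Ints_of_nat]] L2(2)) auto
    finally show ?thesis .
  qed
  have "positive_critical_point n \<gamma> v (\<lambda>w. gp_twist s (p w))"
    unfolding positive_critical_point_iff
  proof
    show "(\<lambda>w. gp_twist s (p w)) \<in> torus_points gp_pos"
      using pt gp_twist_pos sval by (auto simp: torus_points_def gp_twist_mult)
    have "(\<Sum>i=1..n. of_int (v i $ j) * (\<gamma> i * gp_twist s (p (v i)))) =
        gp_twist s (\<Sum>i=1..n. of_int (v i $ j) * (\<gamma> i * p (v i)))" for j
    proof (rule gp_eqI)
      fix x
      have "gp_coeff (\<Sum>i=1..n. of_int (v i $ j) * (\<gamma> i * gp_twist s (p (v i)))) x =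
          gp_coeff (\<Sum>i=1..n. of_int (v i $ j) * gp_twist s (\<gamma> i * p (v i))) x"
        by (simp add: gp_twist_mult twist\<gamma> del: gp_coeff_sum)
      also have "\<dots> = gp_coeff (gp_twist s (\<Sum>i=1..n. of_int (v i $ j) * (\<gamma> i * p (v i)))) x"
        by (simp add: gp_coeff_twist sum_distrib_left mult.left_commute[of "cis _"])
      finally show "gp_coeff (\<Sum>i=1..n. of_int (v i $ j) * (\<gamma> i * gp_twist s (p (v i)))) x =
          gp_coeff (gp_twist s (\<Sum>i=1..n. of_int (v i $ j) * (\<gamma> i * p (v i)))) x" .
    qed
    moreover have "gp_twist s 0 = 0" by (simp add: gp_twist_eq_iff)
    ultimately show "gp_balanced n v (\<lambda>i. \<gamma> i * gp_twist s (p (v i)))"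
      using bal by (simp add: gp_balanced_def)
  qed
  from positive_critical_point_unique[OF v \<gamma>pos p this]
  have "p = (\<lambda>w. gp_twist s (p w))" by blast
  then have "gp_twist s (p w) = p w" for w by metis
  then have "p w \<in> puiseux" for w
    unfolding puiseux_iff gp_twist_eq_iff s_def using L1(1) L2(1) by (metis nat_0_less_mult_iff)
  then show "p \<in> torus_points puiseux_pos"
    using pt by (auto simp: torus_points_def puiseux_pos_def)
qed

section \<open>Asymptotics of real critical points\<close>

text \<open>By completeness the positive sum of exponentials is coercive, so it has a minimum, where
  every directional derivative vanishes.\<close>

lemma complete_exp_critical:
  fixes v :: "nat \<Rightarrow> int ^ 'r" and w :: "nat \<Rightarrow> real"
  assumes v: "complete_exponents n v" and w: "\<And>i. i \<in> {1..n} \<Longrightarrow> w i > 0"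
  obtains u where "\<And>x. (\<Sum>i=1..n. w i * exp (lattice_real (v i) \<bullet> u) * (lattice_real (v i) \<bullet> x)) = 0"
proof -
  define \<Phi> where "\<Phi> u = (\<Sum>i=1..n. w i * exp (lattice_real (v i) \<bullet> u))" for u
  obtain \<epsilon> where \<epsilon>: "\<epsilon> > 0" "\<And>x. \<exists>i\<in>{1..n}. \<epsilon> * norm x \<le> lattice_real (v i) \<bullet> x"
    using complete_coercive[OF v] by blast
  define m where "m = Min (w ` {1..n})"
  have ne: "{1..n} \<noteq> {}" using \<epsilon>(2) by blast
  then have m: "m > 0" unfolding m_def using w by (subst Min_gr_iff) auto
  have low: "m * \<epsilon> * norm u \<le> \<Phi> u" for u
  proof -
    obtain i where i: "i \<in> {1..n}" "\<epsilon> * norm u \<le> lattice_real (v i) \<bullet> u" using \<epsilon>(2) by blast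
    have "\<epsilon> * norm u \<le> exp (lattice_real (v i) \<bullet> u)"
      using i(2) exp_ge_add_one_self[of "lattice_real (v i) \<bullet> u"] by linarith
    moreover have "m \<le> w i" using i(1) by (simp add: m_def)
    ultimately have "m * (\<epsilon> * norm u) \<le> w i * exp (lattice_real (v i) \<bullet> u)"
      using m \<epsilon>(1) by (intro mult_mono) auto
    also have "\<dots> \<le> \<Phi> u" unfolding \<Phi>_def
      using i(1) w by (intro member_le_sum) (auto intro!: mult_nonneg_nonneg less_imp_le)
    finally show ?thesis by (simp add: mult.assoc)
  qed
  \<comment> \<open>Beyond this radius the lower bound exceeds \<open>\<Phi> 0\<close>, so a minimum
    over the ball is global.\<close>
  define R where "R = \<Phi> 0 / (m * \<epsilon>)"
  have "R \<ge> 0" using low[of 0] m \<epsilon> by (simp add: R_def)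
  have "continuous_on (cball 0 R) \<Phi>" unfolding \<Phi>_def by (intro continuous_intros)
  then obtain u where u: "u \<in> cball 0 R" "\<And>y. y \<in> cball 0 R \<Longrightarrow> \<Phi> u \<le> \<Phi> y"
    using continuous_attains_inf[of "cball 0 R" \<Phi>] \<open>R \<ge> 0\<close> by auto
  have min: "\<Phi> u \<le> \<Phi> y" for y
  proof (cases "norm y \<le> R")
    case False
    then have "\<Phi> 0 < m * \<epsilon> * norm y" using m \<epsilon> by (simp add: R_def field_simps)
    moreover have "\<Phi> u \<le> \<Phi> 0" using u(2)[of 0] \<open>R \<ge> 0\<close> by simp
    ultimately show ?thesis using low[of y] by linarith
  qed (use u(2) in auto)
  show ?thesis
  proof
    fix x
    have "((\<lambda>s. \<Phi> (u + s *\<^sub>R x)) has_real_derivative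
        (\<Sum>i=1..n. w i * exp (lattice_real (v i) \<bullet> u) * (lattice_real (v i) \<bullet> x))) (at 0)"
      unfolding \<Phi>_def inner_add_right inner_scaleR_right
      by (auto intro!: derivative_eq_intros sum.cong)
    then show "(\<Sum>i=1..n. w i * exp (lattice_real (v i) \<bullet> u) * (lattice_real (v i) \<bullet> x)) = 0"
      by (rule DERIV_local_min[where d = 1]) (use min in auto)
  qed
qed

lemma common_convergent_subsequence:
  fixes f :: "'a \<Rightarrow> nat \<Rightarrow> real"
  assumes "finite A" "\<And>a. a \<in> A \<Longrightarrow> bounded (range (f a))"
  obtains r :: "nat \<Rightarrow> nat" where "strict_mono r" "\<And>a. a \<in> A \<Longrightarrow> convergent (\<lambda>k. f a (r k))"
proof -
  have "\<exists>r :: nat \<Rightarrow> nat. strict_mono r \<and> (\<forall>a\<in>A. convergent (\<lambda>k. f a (r k)))"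
    using assms
  proof (induction A)
    case empty
    show ?case by (auto intro: strict_mono_id[unfolded id_def])
  next
    case (insert b A)
    then obtain r :: "nat \<Rightarrow> nat" where r: "strict_mono r" "\<forall>a\<in>A. convergent (\<lambda>k. f a (r k))" by auto
    have "bounded (range (\<lambda>k. f b (r k)))"
      using insert.prems[of b] by (auto intro: bounded_subset)
    then obtain l q where q: "strict_mono q" "((\<lambda>k. f b (r k)) \<circ> q) \<longlonglongrightarrow> l"
      using bounded_imp_convergent_subsequence by blast
    have "convergent (\<lambda>k. f a ((r \<circ> q) k))" if "a \<in> insert b A" for a
    proof (cases "a = b")
      case True
      then show ?thesis using q(2) by (auto simp: convergent_def o_def)
    next
      case False
      then have "convergent (\<lambda>k. f a (r k))" using that r(2) by auto
      then show ?thesis using convergent_subseq_convergent[OF _ q(1)] by (auto simp: o_def)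
    qed
    then show ?case using strict_mono_o[OF r(1) q(1)] by blast
  qed
  then show ?thesis using that by blast
qed

text \<open>
  The tropical critical point \<open>d\<close> and the leading coefficients \<open>exp (a $ j)\<close> are read off from the
  critical points \<open>u k\<close> of the real Laurent polynomial at \<open>t = exp (- k)\<close>: along a subsequence for
  which the ratios of the terms converge, \<open>u k = - k d + a + o(1)\<close>.
\<close>

lemma tropical_critical_point:
  fixes v :: "nat \<Rightarrow> int ^ 'r" and g e :: "nat \<Rightarrow> real"
  assumes v: "complete_exponents n v" and g: "\<And>i. i \<in> {1..n} \<Longrightarrow> g i > 0"
  obtains d a where
    "\<And>\<mu> x. (\<And>i. i \<in> {1..n} \<Longrightarrow> e i + lattice_real (v i) \<bullet> d < \<mu> \<Longrightarrow> lattice_real (v i) \<bullet> x = 0) \<Longrightarrow>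
      (\<Sum>i | i \<in> {1..n} \<and> e i + lattice_real (v i) \<bullet> d = \<mu>.
        g i * exp (lattice_real (v i) \<bullet> a) * (lattice_real (v i) \<bullet> x)) = 0"
proof -
  define V where "V i = lattice_real (v i)" for i
  have "\<forall>k. \<exists>u. \<forall>x. (\<Sum>i=1..n. g i * exp (- e i * real k) * exp (V i \<bullet> u) * (V i \<bullet> x)) = 0"
  proof
    fix k
    obtain u where "\<And>x. (\<Sum>i=1..n. g i * exp (- e i * real k) * exp (lattice_real (v i) \<bullet> u) *
        (lattice_real (v i) \<bullet> x)) = 0"
      using complete_exp_critical[OF v, of "\<lambda>i. g i * exp (- e i * real k)"] g by auto
    then show "\<exists>u. \<forall>x. (\<Sum>i=1..n. g i * exp (- e i * real k) * exp (V i \<bullet> u) * (V i \<bullet> x)) = 0"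
      unfolding V_def by blast
  qed
  from choice[OF this] obtain U where U: "\<And>k x. (\<Sum>i=1..n. g i * exp (- e i * real k) * exp (V i \<bullet> U k) * (V i \<bullet> x)) = 0"
    by blast
  \<comment> \<open>\<open>L i k\<close> is the logarithm of the \<open>i\<close>-th term, and
    \<open>h\<close> truncates the ratio of two terms to a bounded sequence; the value 2, isolated
    from the ratios up to 1, flags that the first term is the larger one.\<close>
  define L where "L i k = ln (g i) - e i * real k + V i \<bullet> U k" for i k
  define h where "h = (\<lambda>(i, j) k. if L i k \<le> L j k then exp (L i k - L j k) else 2)"
  have "bounded (range (h ij))" for ij
  proof (rule boundedI)
    fix y assume "y \<in> range (h ij)"
    then show "norm y \<le> 2" by (auto simp: h_def split: prod.splits intro: order_trans[of _ 1])
  qed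
  then obtain r :: "nat \<Rightarrow> nat" where r: "strict_mono r"
    and hr: "\<And>ij. ij \<in> {1..n} \<times> {1..n} \<Longrightarrow> convergent (\<lambda>k. h ij (r k))"
    using common_convergent_subsequence[of "{1..n} \<times> {1..n}" h] by blast
  define M u s where "M i k = L i (r k)" and "u k = U (r k)" and "s k = real (r k)" for i k
  have s: "filterlim s at_top sequentially"
    unfolding s_def using filterlim_compose[OF filterlim_real_sequentially filterlim_subseq[OF r]] .
  have expM: "exp (M i k) = g i * exp (- e i * s k) * exp (V i \<bullet> u k)" if "i \<in> {1..n}" for i k
    using g[OF that] by (simp add: M_def L_def u_def s_def exp_add exp_diff exp_minus divide_inverse)
  have crit: "(\<Sum>i=1..n. exp (M i k) * (V i \<bullet> x)) = 0" for k x
    using U[of "r k" x] by (simp add: expM u_def s_def)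
  have Vu: "V i \<bullet> u k = M i k - ln (g i) + e i * s k" for i k
    by (simp add: M_def L_def u_def s_def)
  \<comment> \<open>Growth of the form \<open>\<alpha> * s k\<close> plus a constant plus o(1). The
    directions along which \<open>u\<close> grows like this form the subspace \<open>A\<close>, and
    the aim is that \<open>A\<close> is the whole space.\<close>
  define Aff where "Aff f \<longleftrightarrow> (\<exists>\<alpha>. convergent (\<lambda>k. f k - \<alpha> * s k))" for f
  have Aff_s: "Aff (\<lambda>k. c + \<alpha> * s k)" for c \<alpha>
    unfolding Aff_def by (intro exI[of _ \<alpha>]) (simp add: convergent_const)
  have Aff_conv: "Aff f" if "convergent f" for f
    unfolding Aff_def using that by (intro exI[of _ 0]) simp
  have Aff_add: "Aff (\<lambda>k. f k + f' k)" if f: "Aff f" and f': "Aff f'" for f f'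
  proof -
    obtain \<alpha> \<alpha>' where "convergent (\<lambda>k. f k - \<alpha> * s k)" "convergent (\<lambda>k. f' k - \<alpha>' * s k)"
      using f f' unfolding Aff_def by blast
    from convergent_add[OF this] show ?thesis
      unfolding Aff_def by (intro exI[of _ "\<alpha> + \<alpha>'"]) (simp add: algebra_simps)
  qed
  have Aff_scale: "Aff (\<lambda>k. c * f k)" if f: "Aff f" for c f
  proof -
    obtain \<alpha> where "convergent (\<lambda>k. f k - \<alpha> * s k)" using f unfolding Aff_def by blast
    from convergent_mult[OF convergent_const[of c] this] show ?thesis
      unfolding Aff_def by (intro exI[of _ "c * \<alpha>"]) (simp add: algebra_simps)
  qed
  have Aff_sum: "Aff (\<lambda>k. \<Sum>j\<in>J. f j k)" if "\<And>j. j \<in> J \<Longrightarrow> Aff (f j)" for f and J :: "nat set"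
    using that Aff_s[of 0 0] by (induction J rule: infinite_finite_induct) (auto intro: Aff_add)
  define A where "A = {x. Aff (\<lambda>k. x \<bullet> u k)}"
  have sub: "subspace A"
    using Aff_s[of 0 0] by (auto simp: subspace_def A_def inner_add_left intro: Aff_add Aff_scale)
  then have spanA: "span A = A" by (simp add: span_eq_iff)
  have VA: "V i \<in> A" if i: "i \<in> {1..n}" for i
  proof (rule ccontr)
    assume "V i \<notin> A"
    \<comment> \<open>Only terms with exponents outside \<open>A\<close> are compared, normalised by
      one of them, \<open>i0\<close>, that is largest among them infinitely often.\<close>
    define J where "J = {i\<in>{1..n}. V i \<notin> A}"
    have J: "finite J" "J \<noteq> {}" using i \<open>V i \<notin> A\<close> by (auto simp: J_def)
    have "\<exists>i\<in>J. \<forall>j\<in>J. M j k \<le> M i k" for k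
    proof -
      have "Max ((\<lambda>i. M i k) ` J) \<in> (\<lambda>i. M i k) ` J" using J by (intro Max_in) auto
      then obtain i where "i \<in> J" "M i k = Max ((\<lambda>i. M i k) ` J)" by auto
      then show ?thesis using J by (intro bexI[of _ i]) auto
    qed
    then obtain I where I: "\<And>k. I k \<in> J" "\<And>k j. j \<in> J \<Longrightarrow> M j k \<le> M (I k) k" by metis
    have "finite (range I)" using I(1) J(1) by (meson finite_subset image_subsetI)
    then obtain k0 where k0: "infinite {k. I k = I k0}"
      using pigeonhole_infinite[of "UNIV :: nat set" I] by auto
    define i0 where "i0 = I k0"
    have i0: "i0 \<in> J" using I(1) by (simp add: i0_def)
    have "\<exists>l. (\<lambda>k. exp (M j k - M i0 k)) \<longlonglongrightarrow> l" if j: "j \<in> J" for j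
    proof -
      have "convergent (\<lambda>k. h (j, i0) (r k))" using hr j i0 by (auto simp: J_def)
      then obtain l where l: "(\<lambda>k. h (j, i0) (r k)) \<longlonglongrightarrow> l" by (auto simp: convergent_def)
      have hM: "h (j, i0) (r k) = (if M j k \<le> M i0 k then exp (M j k - M i0 k) else 2)" for k
        by (simp add: h_def M_def)
      \<comment> \<open>At some late index \<open>h\<close> is at most 1, so its limit is below 5/4
        and \<open>h\<close> stays below 3/2 from \<open>N\<close> on. This excludes the flag 2, and
        \<open>h\<close> is the genuine ratio.\<close>
      obtain N where N: "\<And>k. k \<ge> N \<Longrightarrow> \<bar>h (j, i0) (r k) - l\<bar> < 1 / 4"
        using LIMSEQ_D[OF l, of "1/4"] by auto
      obtain k where k: "k \<ge> N" "I k = i0"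
        using k0 unfolding infinite_nat_iff_unbounded_le i0_def by auto
      then have "h (j, i0) (r k) \<le> 1" using I(2)[OF j, of k] by (simp add: hM)
      then have "l < 5 / 4" using N[OF k(1)] by linarith
      then have "M j k \<le> M i0 k" if "k \<ge> N" for k
        using N[OF that] by (auto simp: hM split: if_splits)
      then have "eventually (\<lambda>k. h (j, i0) (r k) = exp (M j k - M i0 k)) sequentially"
        unfolding eventually_sequentially by (intro exI[of _ N]) (simp add: hM)
      from Lim_transform_eventually[OF l this] show ?thesis by blast
    qed
    then obtain l where l: "\<And>j. j \<in> J \<Longrightarrow> (\<lambda>k. exp (M j k - M i0 k)) \<longlonglongrightarrow> l j" by metis
    have l0: "l j \<ge> 0" if "j \<in> J" for j
      by (rule LIMSEQ_le_const[OF l[OF that]]) auto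
    have l1: "l i0 = 1" using l[OF i0] by (simp add: LIMSEQ_const_iff)
    \<comment> \<open>The limit of the normalised critical equation, restricted to \<open>J\<close>.
      Tested against the component \<open>z\<close> of \<open>w\<close> orthogonal to
      \<open>A\<close>, where all other terms vanish, the equation gives \<open>z = 0\<close>; so
      \<open>w\<close> lies in \<open>A\<close>.\<close>
    define w where "w = (\<Sum>j\<in>J. l j *\<^sub>R V j)"
    obtain y z where yz: "y \<in> span A" "\<And>x. x \<in> span A \<Longrightarrow> orthogonal z x" "w = y + z"
      using orthogonal_subspace_decomp_exists[of A w] by blast
    have zA: "x \<bullet> z = 0" if "x \<in> A" for x
      using yz(2)[of x] that spanA by (simp add: orthogonal_def inner_commute)
    have "(\<Sum>j\<in>J. exp (M j k - M i0 k) * (V j \<bullet> z)) = 0" for k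
    proof -
      have "(\<Sum>j\<in>J. exp (M j k) * (V j \<bullet> z)) = (\<Sum>i=1..n. exp (M i k) * (V i \<bullet> z))"
        by (rule sum.mono_neutral_left) (auto simp: J_def zA)
      then have "(\<Sum>j\<in>J. exp (M j k) * (V j \<bullet> z)) / exp (M i0 k) = 0" using crit by simp
      then show ?thesis by (simp add: sum_divide_distrib exp_diff)
    qed
    moreover have "(\<lambda>k. \<Sum>j\<in>J. exp (M j k - M i0 k) * (V j \<bullet> z)) \<longlonglongrightarrow> (\<Sum>j\<in>J. l j * (V j \<bullet> z))"
      by (intro tendsto_sum tendsto_mult l tendsto_const)
    ultimately have "(\<Sum>j\<in>J. l j * (V j \<bullet> z)) = 0" by (simp add: LIMSEQ_const_iff)
    then have "w \<bullet> z = 0" by (simp add: w_def inner_sum_left)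
    moreover have "y \<bullet> z = 0" using yz(1) spanA zA by simp
    ultimately have "z = 0" using yz(3) by (simp add: inner_add_left)
    then have "w \<in> A" using yz spanA by simp
    then have Aw: "Aff (\<lambda>k. w \<bullet> u k)" by (simp add: A_def)
    \<comment> \<open>For nonzero \<open>l j\<close> the logarithms of the ratios converge, and
      otherwise the factor removes them. Thus \<open>w \<bullet> u k\<close> and
      \<open>sum l J * M i0 k\<close> differ by an affinely growing quantity, and
      \<open>M i0\<close> grows affinely, putting \<open>V i0\<close> in \<open>A\<close>.\<close>
    have "Aff (\<lambda>k. l j * (M j k - M i0 k))" if j: "j \<in> J" for j
    proof (cases "l j = 0")
      case True
      then show ?thesis using Aff_s[of 0 0] by simp
    next
      case False
      then have "(\<lambda>k. ln (exp (M j k - M i0 k))) \<longlonglongrightarrow> ln (l j)"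
        using l[OF j] by (intro tendsto_ln)
      then show ?thesis by (intro Aff_scale Aff_conv) (auto simp: convergent_def)
    qed
    then have A1: "Aff (\<lambda>k. \<Sum>j\<in>J. l j * (M j k - M i0 k))" by (rule Aff_sum)
    have "Aff (\<lambda>k. w \<bullet> u k + (- 1) * (\<Sum>j\<in>J. l j * (M j k - M i0 k))
        + ((\<Sum>j\<in>J. l j * ln (g j)) + (- (\<Sum>j\<in>J. l j * e j)) * s k))"
      by (intro Aff_add Aff_scale Aff_s Aw A1)
    also have "(\<lambda>k. w \<bullet> u k + (- 1) * (\<Sum>j\<in>J. l j * (M j k - M i0 k))
        + ((\<Sum>j\<in>J. l j * ln (g j)) + (- (\<Sum>j\<in>J. l j * e j)) * s k)) = (\<lambda>k. sum l J * M i0 k)"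
      by (simp add: w_def inner_sum_left Vu algebra_simps sum.distrib sum_subtractf sum_negf sum_distrib_left
        flip: sum_distrib_right)
    finally have "Aff (\<lambda>k. inverse (sum l J) * (sum l J * M i0 k))" by (rule Aff_scale)
    moreover have "sum l J > 0"
      using J(1) i0 l0 l1 by (intro sum_pos2[of J i0]) auto
    ultimately have "Aff (M i0)" by (simp add: mult.assoc[symmetric])
    from Aff_add[OF this Aff_s[of "- ln (g i0)" "e i0"]] have "V i0 \<in> A"
      by (simp add: A_def Vu algebra_simps)
    then show False using i0 by (simp add: J_def)
  qed
  have "x \<in> A" for x
  proof -
    obtain y z where yz: "y \<in> span A" "\<And>x. x \<in> span A \<Longrightarrow> orthogonal z x" "x = y + z"
      using orthogonal_subspace_decomp_exists[of A x] by blast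
    have "V i \<bullet> z = 0" if "i \<in> {1..n}" for i
      using yz(2)[of "V i"] VA[OF that] spanA by (simp add: orthogonal_def inner_commute)
    then have "z = 0" by (intro complete_separates[OF v]) (simp add: V_def)
    with yz spanA show ?thesis by simp
  qed
  from this[of "axis _ 1"] have "Aff (\<lambda>k. u k $ j)" for j
    by (simp add: A_def inner_axis')
  then have "\<exists>\<alpha> \<beta>. (\<lambda>k. u k $ j - \<alpha> * s k) \<longlonglongrightarrow> \<beta>" for j
    unfolding Aff_def convergent_def by blast
  then obtain \<alpha> \<beta> where \<alpha>\<beta>: "\<And>j. (\<lambda>k. u k $ j - \<alpha> j * s k) \<longlonglongrightarrow> \<beta> j" by metis
  \<comment> \<open>The minus sign reflects \<open>t = exp (- s)\<close>: growth
    \<open>\<alpha> j * s\<close> of a logarithm is the power of \<open>t\<close> with exponent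
    \<open>- \<alpha> j\<close>.\<close>
  define d where "d = (\<chi> j. - \<alpha> j)"
  define a where "a = (\<chi> j. \<beta> j)"
  have lim: "(\<lambda>k. u k + s k *\<^sub>R d) \<longlonglongrightarrow> a"
    using \<alpha>\<beta> by (intro vec_tendstoI) (simp add: a_def d_def mult.commute)
  show ?thesis
  proof (rule that)
    fix \<mu> x
    assume x: "\<And>i. i \<in> {1..n} \<Longrightarrow> e i + lattice_real (v i) \<bullet> d < \<mu> \<Longrightarrow> lattice_real (v i) \<bullet> x = 0"
    define c where "c i = e i + V i \<bullet> d" for i
    \<comment> \<open>The scaling separates levels: terms below \<open>\<mu>\<close> are annihilated
      by \<open>x\<close>, terms above it decay, and those at level \<open>\<mu>\<close> survive in
      the limit.\<close>
    have "(\<lambda>k. exp (\<mu> * s k) * exp (M i k) * (V i \<bullet> x)) \<longlonglongrightarrow>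
        (if c i = \<mu> then g i * exp (V i \<bullet> a) * (V i \<bullet> x) else 0)" if i: "i \<in> {1..n}" for i
    proof -
      have eq: "exp (\<mu> * s k) * exp (M i k) =
          exp (- ((c i - \<mu>) * s k)) * (g i * exp (V i \<bullet> (u k + s k *\<^sub>R d)))" for k
        by (simp add: expM[OF i] c_def inner_add_right algebra_simps flip: exp_add)
      have lim': "(\<lambda>k. g i * exp (V i \<bullet> (u k + s k *\<^sub>R d))) \<longlonglongrightarrow> g i * exp (V i \<bullet> a)"
        by (intro tendsto_intros lim)
      consider "c i < \<mu>" | "c i = \<mu>" | "c i > \<mu>" by linarith
      then show ?thesis
      proof cases
        case 1
        then show ?thesis using x[OF i] by (simp add: c_def V_def)
      next
        case 2
        then show ?thesis unfolding eq using tendsto_mult[OF lim' tendsto_const[of "V i \<bullet> x"]] by simp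
      next
        case 3
        then have "filterlim (\<lambda>k. (c i - \<mu>) * s k) at_top sequentially"
          using s by (intro filterlim_tendsto_pos_mult_at_top[OF tendsto_const]) auto
        then have "(\<lambda>k. exp (- ((c i - \<mu>) * s k))) \<longlonglongrightarrow> 0"
          by (intro filterlim_compose[OF exp_at_bot]) (simp add: filterlim_uminus_at_bot)
        from tendsto_mult[OF tendsto_mult[OF this lim'] tendsto_const[of "V i \<bullet> x"]]
        show ?thesis unfolding eq using 3 by simp
      qed
    qed
    then have "(\<lambda>k. \<Sum>i=1..n. exp (\<mu> * s k) * exp (M i k) * (V i \<bullet> x)) \<longlonglongrightarrow>
        (\<Sum>i=1..n. if c i = \<mu> then g i * exp (V i \<bullet> a) * (V i \<bullet> x) else 0)"
      by (rule tendsto_sum)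
    moreover have "(\<Sum>i=1..n. exp (\<mu> * s k) * exp (M i k) * (V i \<bullet> x)) = 0" for k
      using crit[of k x] by (simp add: mult.assoc flip: sum_distrib_left)
    ultimately have "(\<Sum>i=1..n. if c i = \<mu> then g i * exp (V i \<bullet> a) * (V i \<bullet> x) else 0) = 0"
      by (simp add: LIMSEQ_const_iff)
    then have "(\<Sum>i | i \<in> {1..n} \<and> c i = \<mu>. g i * exp (V i \<bullet> a) * (V i \<bullet> x)) = 0"
      by (subst sum.inter_filter) simp_all
    then show "(\<Sum>i | i \<in> {1..n} \<and> e i + lattice_real (v i) \<bullet> d = \<mu>.
        g i * exp (lattice_real (v i) \<bullet> a) * (lattice_real (v i) \<bullet> x)) = 0"
      by (simp only: c_def V_def)
  qed
qed

section \<open>Existence by Newton iteration\<close>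

text \<open>The critical equation for the correction factor \<open>1 - z\<close>, linearised in
  \<open>z\<close>. Its matrix is a weighted Gram matrix of the exponents; the uniform bound with
  zero right-hand side puts its kernel in every order, so the square matrix is injective and hence
  invertible.\<close>

lemma gp_newton_ex:
  fixes v :: "nat \<Rightarrow> int ^ 'r"
  assumes v: "complete_exponents n v" and m: "\<And>i. i \<in> {1..n} \<Longrightarrow> m i \<in> gp_pos"
  shows "\<exists>z. gp_balanced n v (\<lambda>i. m i * (lat_pair (v i) z - 1))"
proof -
  define H :: "gpuiseux ^ 'r ^ 'r" where
    "H = (\<chi> j l. \<Sum>i=1..n. of_int (v i $ j) * (m i * of_int (v i $ l)))"
  have H: "(H *v z) $ j = (\<Sum>i=1..n. of_int (v i $ j) * (m i * lat_pair (v i) z))" for z j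
    by (simp add: H_def matrix_vector_mult_def lat_pair_def sum_distrib_left sum_distrib_right
        mult.assoc sum.swap[of _ UNIV])
  have "z = 0" if "H *v z = 0" for z
  proof -
    have bal: "gp_balanced n v (\<lambda>i. m i * (lat_pair (v i) z - 0))"
      using that H[of z] by (simp add: gp_balanced_def)
    have "z $ j \<in> gp_O \<mu>" for j \<mu>
      by (rule gp_balanced_bound[OF v m _ bal]) simp_all
    then have "z $ j = 0" for j by (intro gp_O_all_zero[of 1 "z $ j" 0]) auto
    then show ?thesis by (simp add: vec_eq_iff)
  qed
  then have "\<exists>B. B ** H = mat 1" unfolding matrix_left_invertible_ker by blast
  then obtain B where HB: "H ** B = mat 1" using matrix_left_right_inverse by blast
  define z where "z = B *v (\<chi> j. \<Sum>i=1..n. of_int (v i $ j) * m i)"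
  have "H *v z = (\<chi> j. \<Sum>i=1..n. of_int (v i $ j) * m i)"
    unfolding z_def matrix_vector_mul_assoc HB matrix_vector_mul_lid ..
  then have "(\<Sum>i=1..n. of_int (v i $ j) * (m i * lat_pair (v i) z)) = (\<Sum>i=1..n. of_int (v i $ j) * m i)" for j
    using H[of z j] by simp
  then have "gp_balanced n v (\<lambda>i. m i * (lat_pair (v i) z - 1))"
    by (simp add: gp_balanced_def right_diff_distrib sum_subtractf)
  then show ?thesis by blast
qed

text \<open>Quadratic convergence: subtracting the old Newton equation from the new one leaves, up
  to a unit, the linearisation error \<open>\<epsilon> i\<close> of the update as right-hand side,
  to which the uniform bound applies.\<close>

lemma gp_newton_step:
  fixes v :: "nat \<Rightarrow> int ^ 'r" and z :: "gpuiseux ^ 'r"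
  assumes v: "complete_exponents n v" and m: "\<And>i. i \<in> {1..n} \<Longrightarrow> m i \<in> gp_pos"
    and z: "\<And>j. z $ j \<in> gp_O \<mu>" and \<mu>: "\<mu> > 0"
    and bal: "gp_balanced n v (\<lambda>i. m i * (lat_pair (v i) z - 1))"
  shows "\<exists>z'. (\<forall>j. z' $ j \<in> gp_O (2 * \<mu>)) \<and>
    gp_balanced n v (\<lambda>i. m i * gp_mon (\<chi> j. 1 - z $ j) (v i) * (lat_pair (v i) z' - 1))"
proof -
  define M where "M i = gp_mon (\<chi> j. 1 - z $ j) (v i)" for i
  have mz: "(- z) $ j \<in> gp_O \<mu>" for j using z by (simp add: gp_O_uminus)
  have "1 - z $ j \<in> gp_pos" for j using gp_unit_pos(1)[OF mz \<mu>, of j] by simp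
  then have M: "M i \<in> gp_pos" for i unfolding M_def by (intro gp_mon_pos) simp
  define \<epsilon> where "\<epsilon> i = M i - 1 + lat_pair (v i) z" for i
  have \<epsilon>: "\<epsilon> i \<in> gp_O (2 * \<mu>)" for i
    using gp_mon_unit[OF mz \<mu>, of "v i"]
    by (simp add: \<epsilon>_def M_def lat_pair_def sum_negf)
  have invM: "inverse (M i) \<in> gp_O 0" for i
  proof -
    have "\<epsilon> i - lat_pair (v i) z \<in> gp_O \<mu>"
      using \<epsilon>[of i] \<mu> z by (intro gp_O_diff gp_O_lat_pair) (auto intro: gp_O_mono)
    from gp_unit_inverse[OF this \<mu>] show ?thesis by (simp add: \<epsilon>_def)
  qed
  have mM: "m i * M i \<in> gp_pos" if "i \<in> {1..n}" for i using m[OF that] M by (rule gp_pos_mult)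
  then obtain z' :: "gpuiseux ^ 'r" where z': "gp_balanced n v (\<lambda>i. m i * M i * (lat_pair (v i) z' - 1))"
    using gp_newton_ex[OF v, of "\<lambda>i. m i * M i"] by auto
  have "(\<lambda>i. m i * M i * (lat_pair (v i) z' - 1) - m i * (lat_pair (v i) z - 1)) =
      (\<lambda>i. m i * M i * (lat_pair (v i) z' - inverse (M i) * \<epsilon> i))"
  proof
    fix i
    have "M i \<noteq> 0" using M gp_posD(1) by blast
    then show "m i * M i * (lat_pair (v i) z' - 1) - m i * (lat_pair (v i) z - 1) =
        m i * M i * (lat_pair (v i) z' - inverse (M i) * \<epsilon> i)"
      by (simp add: \<epsilon>_def field_simps)
  qed
  with gp_balanced_diff[OF z' bal]
  have "gp_balanced n v (\<lambda>i. m i * M i * (lat_pair (v i) z' - inverse (M i) * \<epsilon> i))" by simp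
  then have "z' $ j \<in> gp_O (2 * \<mu>)" for j
    using mM gp_O_mult0[OF invM \<epsilon>] by (intro gp_balanced_bound[OF v]) auto
  with z' show ?thesis unfolding M_def by blast
qed

lemma gp_newton_limit:
  fixes v :: "nat \<Rightarrow> int ^ 'r" and z :: "gpuiseux ^ 'r"
  assumes v: "complete_exponents n v" and m: "\<And>i. i \<in> {1..n} \<Longrightarrow> m i \<in> gp_pos"
    and z: "\<And>j. z $ j \<in> gp_O \<mu>" and \<mu>: "\<mu> > 0"
    and bal: "gp_balanced n v (\<lambda>i. m i * (lat_pair (v i) z - 1))"
  obtains x :: "gpuiseux ^ 'r" where "\<And>j. x $ j \<in> gp_pos" "gp_balanced n v (\<lambda>i. m i * gp_mon x (v i))"
proof -
  \<comment> \<open>The invariant keeps only linear growth of the order of the next correction,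
    weaker than doubling but enough for convergence, and holds the iterates near the
    identity.\<close>
  define P where "P k x \<longleftrightarrow> (\<forall>j. x $ j - 1 \<in> gp_O \<mu>) \<and> (\<exists>z. (\<forall>j. z $ j \<in> gp_O (of_nat (Suc k) * \<mu>)) \<and>
      gp_balanced n v (\<lambda>i. m i * gp_mon x (v i) * (lat_pair (v i) z - 1)))" for k and x :: "gpuiseux ^ 'r"
  have pos: "x $ j \<in> gp_pos" if "P k x" for k j and x :: "gpuiseux ^ 'r"
  proof -
    have "x $ j - 1 \<in> gp_O \<mu>" using that by (simp add: P_def)
    from gp_unit_pos(1)[OF this \<mu>] show ?thesis by simp
  qed
  have P0: "P 0 (\<chi> j. 1)"
    using z bal by (auto simp: P_def gp_mon_def)
  have step: "\<exists>y :: gpuiseux ^ 'r. P (Suc k) y \<and> (\<forall>j. y $ j - x $ j \<in> gp_O (of_nat k * \<mu>))"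
    if x: "P k x" for k and x :: "gpuiseux ^ 'r"
  proof -
    obtain z :: "gpuiseux ^ 'r" where z: "\<And>j. z $ j \<in> gp_O (of_nat (Suc k) * \<mu>)"
      "gp_balanced n v (\<lambda>i. m i * gp_mon x (v i) * (lat_pair (v i) z - 1))"
      using x by (auto simp: P_def)
    define y where "y = (\<chi> j. x $ j * (\<chi> j. 1 - z $ j) $ j)"
    have k: "of_nat (Suc k) * \<mu> > 0" using \<mu> by simp
    have "m i * gp_mon x (v i) \<in> gp_pos" if "i \<in> {1..n}" for i
      using m[OF that] pos[OF x] by (intro gp_pos_mult gp_mon_pos)
    from gp_newton_step[OF v this z(1) k z(2)]
    obtain z' :: "gpuiseux ^ 'r" where z': "\<And>j. z' $ j \<in> gp_O (2 * (of_nat (Suc k) * \<mu>))"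
      "gp_balanced n v (\<lambda>i. m i * gp_mon x (v i) * gp_mon (\<chi> j. 1 - z $ j) (v i) * (lat_pair (v i) z' - 1))"
      by blast
    have "z' $ j \<in> gp_O (of_nat (Suc (Suc k)) * \<mu>)" for j
      using z'(1) by (rule gp_O_mono) (use \<mu> in \<open>simp add: algebra_simps\<close>)
    moreover have "gp_mon y w = gp_mon x w * gp_mon (\<chi> j. 1 - z $ j) w" for w
      unfolding y_def by (rule gp_mon_mult)
    then have "gp_balanced n v (\<lambda>i. m i * gp_mon y (v i) * (lat_pair (v i) z' - 1))"
      using z'(2) by (simp add: mult.assoc)
    moreover have diff: "y $ j - x $ j \<in> gp_O (of_nat (Suc k) * \<mu>)" for j
    proof -
      have "x $ j \<in> gp_O 0"
      proof -
        have "x $ j - 1 + 1 \<in> gp_O 0" using x \<mu>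
          by (intro gp_O_add) (auto simp: P_def intro: gp_O_mono)
        then show ?thesis by simp
      qed
      from gp_O_uminus[OF gp_O_mult0[OF this z(1)[of j]]] show ?thesis
        by (simp add: y_def algebra_simps)
    qed
    moreover have "y $ j - 1 \<in> gp_O \<mu>" for j
    proof -
      have "y $ j - x $ j + (x $ j - 1) \<in> gp_O \<mu>"
        using x \<mu> by (intro gp_O_add gp_O_mono[OF diff]) (auto simp: P_def algebra_simps)
      then show ?thesis by simp
    qed
    moreover have "y $ j - x $ j \<in> gp_O (of_nat k * \<mu>)" for j
      using diff by (rule gp_O_mono) (use \<mu> in \<open>simp add: algebra_simps\<close>)
    ultimately show ?thesis unfolding P_def by blast
  qed
  obtain X :: "nat \<Rightarrow> gpuiseux ^ 'r" where X: "\<And>k. P k (X k)" "\<And>k j. X (Suc k) $ j - X k $ j \<in> gp_O (of_nat k * \<mu>)"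
    using dependent_nat_choice[of P "\<lambda>k (x :: gpuiseux ^ 'r) (y :: gpuiseux ^ 'r). \<forall>j. y $ j - x $ j \<in> gp_O (of_nat k * \<mu>)"] P0 step by blast
  have "\<exists>y. \<forall>k. y - X k $ j \<in> gp_O (of_nat k * \<mu>)" for j
    by (rule gp_lim[OF \<mu> X(2)[of _ j]]) blast
  then obtain x :: "'r \<Rightarrow> gpuiseux" where x: "\<And>j k. x j - X k $ j \<in> gp_O (of_nat k * \<mu>)" by metis
  \<comment> \<open>A common lower bound for the valuations of the weights; it only shifts the
    orders of the residuals.\<close>
  define c where "c = Min ((\<lambda>i. gp_val (m i)) ` {1..n})"
  have mc: "m i \<in> gp_O c" if "i \<in> {1..n}" for i
    using gp_O_val by (rule gp_O_mono) (use that in \<open>simp add: c_def\<close>)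
  show ?thesis
  proof
    fix j
    have "x j - X 1 $ j + (X 1 $ j - 1) \<in> gp_O \<mu>"
      using x[of j 1] X(1)[of 1] by (intro gp_O_add) (auto simp: P_def)
    from gp_unit_pos(1)[OF this \<mu>] show "(\<chi> j. x j) $ j \<in> gp_pos" by simp
  next
    show "gp_balanced n v (\<lambda>i. m i * gp_mon (\<chi> j. x j) (v i))"
      unfolding gp_balanced_def
    proof (intro allI gp_O_all_zero[OF \<mu>])
      fix j and k :: nat
      \<comment> \<open>The index \<open>Suc k\<close> keeps \<open>\<kappa>\<close> positive for
        \<open>k = 0\<close>, as the linearisation of characters requires.\<close>
      define K \<kappa> where "K = X (Suc k)" and "\<kappa> = of_nat (Suc k) * \<mu>"
      have \<kappa>: "\<kappa> > 0" using \<mu> by (simp add: \<kappa>_def)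
      have K: "P (Suc k) K" using X(1) by (simp add: K_def)
      then obtain z :: "gpuiseux ^ 'r" where z: "\<And>j. z $ j \<in> gp_O (of_nat (Suc (Suc k)) * \<mu>)"
        "gp_balanced n v (\<lambda>i. m i * gp_mon K (v i) * (lat_pair (v i) z - 1))"
        by (auto simp: P_def)
      have z\<kappa>: "z $ j \<in> gp_O \<kappa>" for j
        using z(1) by (rule gp_O_mono) (use \<mu> in \<open>simp add: \<kappa>_def algebra_simps\<close>)
      have Kunit: "K $ j - 1 \<in> gp_O \<mu>" for j using K by (simp add: P_def)
      have invK: "inverse (K $ j) \<in> gp_O 0" for j using gp_unit_inverse[OF Kunit \<mu>, of j] by simp
      have Knz: "K $ j \<noteq> 0" for j using pos[OF K] gp_posD(1) by blast
      define y where "y = (\<chi> j. inverse (K $ j) * (x j - K $ j))"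
      have y: "y $ j \<in> gp_O \<kappa>" for j
        using gp_O_mult0[OF invK x[of j "Suc k"]] by (simp add: y_def K_def \<kappa>_def)
      have xy: "(\<chi> j. x j) = (\<chi> j. K $ j * (\<chi> l. 1 + y $ l) $ j)"
        using Knz by (simp add: y_def vec_eq_iff distrib_left mult.assoc[symmetric])
      define N where "N i = gp_mon (\<chi> l. 1 + y $ l) (v i)" for i
      have mon: "gp_mon (\<chi> j. x j) (v i) = gp_mon K (v i) * N i" for i
        unfolding xy N_def by (rule gp_mon_mult)
      have N: "N i - 1 + lat_pair (v i) z \<in> gp_O \<kappa>" for i
      proof -
        have "N i - 1 - lat_pair (v i) y \<in> gp_O (2 * \<kappa>)"
          using gp_mon_unit[OF y \<kappa>, of "v i"] by (simp add: N_def lat_pair_def)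
        then have "N i - 1 - lat_pair (v i) y + lat_pair (v i) y + lat_pair (v i) z \<in> gp_O \<kappa>"
          using \<kappa> y z\<kappa> by (intro gp_O_add gp_O_lat_pair) (auto intro: gp_O_mono)
        then show ?thesis by simp
      qed
      have Kmon: "gp_mon K (v i) \<in> gp_O 0" for i
      proof -
        have "gp_mon (\<chi> l. 1 + (K - 1) $ l) (v i) - 1 - lat_pair (v i) (K - 1) \<in> gp_O (2 * \<mu>)"
          unfolding lat_pair_def by (rule gp_mon_unit[OF _ \<mu>]) (use Kunit in simp)
        then have "gp_mon K (v i) - 1 - lat_pair (v i) (K - 1) + 1 + lat_pair (v i) (K - 1) \<in> gp_O 0"
          using \<mu> gp_O_mono[OF Kunit, of 0]
          by (intro gp_O_add gp_O_lat_pair) (auto intro: gp_O_mono)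
        then show ?thesis by simp
      qed
      \<comment> \<open>Adding the Newton equation at \<open>K\<close> gives the residual at the
        limit the factors \<open>N i - 1 + lat_pair (v i) z\<close>, small because both the distance
        from \<open>K\<close> to the limit and the next correction are.\<close>
      have "(\<Sum>i=1..n. of_int (v i $ j) * (m i * gp_mon (\<chi> j. x j) (v i))) =
          (\<Sum>i=1..n. of_int (v i $ j) * (m i * (gp_mon K (v i) * (N i - 1 + lat_pair (v i) z)))) -
          (\<Sum>i=1..n. of_int (v i $ j) * (m i * gp_mon K (v i) * (lat_pair (v i) z - 1)))"
        unfolding sum_subtractf[symmetric] by (intro sum.cong) (auto simp: mon algebra_simps)
      also have "\<dots> = (\<Sum>i=1..n. of_int (v i $ j) * (m i * (gp_mon K (v i) * (N i - 1 + lat_pair (v i) z))))"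
        using z(2) by (simp add: gp_balanced_def)
      also have "\<dots> \<in> gp_O (c + \<kappa>)"
        using mc by (intro gp_O_sum gp_O_of_int_mult gp_O_mult gp_O_mult0[OF Kmon N]) auto
      finally have "(\<Sum>i=1..n. of_int (v i $ j) * (m i * gp_mon (\<chi> j. x j) (v i))) \<in> gp_O (c + \<kappa>)" .
      then show "(\<Sum>i=1..n. of_int (v i $ j) * (m i * gp_mon (\<chi> j. x j) (v i))) \<in> gp_O (c + of_nat k * \<mu>)"
        by (rule gp_O_mono) (use \<mu> in \<open>simp add: \<kappa>_def algebra_simps\<close>)
    qed
  qed
qed

text \<open>The tropical data give the first approximation \<open>T\<close>. The work lies in
  showing that its Newton correction has positive order, after which the iteration
  converges.\<close>

lemma positive_critical_point_exists:
  fixes v :: "nat \<Rightarrow> int ^ 'r"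
  assumes v: "complete_exponents n v" and \<gamma>: "\<And>i. i \<in> {1..n} \<Longrightarrow> \<gamma> i \<in> gp_pos"
  shows "\<exists>p. positive_critical_point n \<gamma> v p"
proof -
  define V where "V i = lattice_real (v i)" for i
  obtain d a where da:
    "\<And>\<mu> x. (\<And>i. i \<in> {1..n} \<Longrightarrow> gp_val (\<gamma> i) + V i \<bullet> d < \<mu> \<Longrightarrow> V i \<bullet> x = 0) \<Longrightarrow>
      (\<Sum>i | i \<in> {1..n} \<and> gp_val (\<gamma> i) + V i \<bullet> d = \<mu>.
        Re (gp_lead (\<gamma> i)) * exp (V i \<bullet> a) * (V i \<bullet> x)) = 0"
    unfolding V_def
    using tropical_critical_point[OF v, of "\<lambda>i. Re (gp_lead (\<gamma> i))" "\<lambda>i. gp_val (\<gamma> i)"] gp_posD(3)[OF \<gamma>]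
    by blast
  define T where "T = (\<chi> j. gp_monom (of_real (exp (a $ j))) (d $ j))"
  have T: "T $ j \<in> gp_pos" for j by (simp add: T_def gp_pos_monom)
  define m where "m i = \<gamma> i * gp_mon T (v i)" for i
  define c where "c i = gp_val (\<gamma> i) + V i \<bullet> d" for i
  define G where "G i = Re (gp_lead (\<gamma> i)) * exp (V i \<bullet> a)" for i
  have monT: "gp_mon T (v i) = gp_monom (of_real (exp (V i \<bullet> a))) (V i \<bullet> d)" for i
    unfolding T_def V_def by (rule gp_mon_monom)
  have m: "m i \<in> gp_pos" "gp_val (m i) = c i" "gp_lead (m i) = of_real (G i)" "G i > 0" if "i \<in> {1..n}" for i
  proof -
    have nz: "\<gamma> i \<noteq> 0" "gp_mon T (v i) \<noteq> 0"
      using \<gamma>[OF that] gp_mon_pos[OF T] gp_posD(1) by blast+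
    show "m i \<in> gp_pos" using \<gamma>[OF that] gp_mon_pos[OF T] by (simp add: m_def gp_pos_mult)
    show "gp_val (m i) = c i" using nz by (simp add: m_def gp_val_mult) (simp add: monT gp_val_monom c_def)
    show "gp_lead (m i) = of_real (G i)"
      using nz gp_posD(2)[OF \<gamma>[OF that]] by (simp add: m_def gp_lead_mult) (simp add: monT gp_lead_monom G_def)
    show "G i > 0" using gp_posD(3)[OF \<gamma>[OF that]] by (simp add: G_def)
  qed
  obtain z :: "gpuiseux ^ 'r" where z: "gp_balanced n v (\<lambda>i. m i * (lat_pair (v i) z - 1))"
    using gp_newton_ex[OF v, of m] m(1) by blast
  have "\<exists>\<mu>>0. \<forall>j. z $ j \<in> gp_O \<mu>"
  proof (cases "z = 0")
    case True
    then show ?thesis by (intro exI[of _ 1]) simp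
  next
    case False
    then obtain \<nu> where \<nu>: "\<And>l. z $ l \<in> gp_O \<nu>" "(\<chi> l. gp_coeff (z $ l) \<nu>) \<noteq> 0"
      using gp_vec_lowest by blast
    have "\<nu> > 0"
    proof (rule ccontr)
      assume "\<not> \<nu> > 0"
      \<comment> \<open>For nonpositive \<open>\<nu>\<close>, the equation is paired with the
        conjugate of \<open>b\<close> and read off at exponent \<open>\<mu> + \<nu>\<close>, where
        \<open>\<mu>\<close> is the lowest valuation of a term whose exponent pairs nontrivially
        with \<open>b\<close>.\<close>
      define b where "b = (\<chi> l. gp_coeff (z $ l) \<nu>)"
      define J where "J = {i\<in>{1..n}. lat_pair (v i) b \<noteq> 0}"
      have J: "finite J" "J \<noteq> {}"
        using complete_separates_complex[OF v, of b] \<nu>(2) by (auto simp: J_def b_def)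
      define \<mu> where "\<mu> = Min (c ` J)"
      have "\<mu> \<in> c ` J" unfolding \<mu>_def using J by (intro Min_in) auto
      then obtain k where k: "k \<in> J" "c k = \<mu>" by auto
      have low: "lat_pair (v i) b = 0" if "i \<in> {1..n}" "c i < \<mu>" for i
      proof -
        have "i \<notin> J"
        proof
          assume "i \<in> J"
          then have "\<mu> \<le> c i" unfolding \<mu>_def using J(1) by (intro Min_le) auto
          with that(2) show False by simp
        qed
        then show ?thesis using that(1) by (simp add: J_def)
      qed
      \<comment> \<open>Exponents of terms below level \<open>\<mu>\<close> annihilate
        \<open>b\<close>, hence its real part, which is thus an admissible direction for the
        tropical condition at \<open>\<mu>\<close>.\<close>
      define x where "x = (\<chi> l. Re (b $ l))"
      have Re_pair: "Re (lat_pair (v i) b) = V i \<bullet> x" for i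
        by (simp add: lat_pair_def x_def V_def lattice_real_def inner_vec_def)
      have G0: "(\<Sum>i | i \<in> {1..n} \<and> c i = \<mu>. G i * (V i \<bullet> x)) = 0"
        unfolding G_def c_def
      proof (rule da)
        fix i assume "i \<in> {1..n}" "gp_val (\<gamma> i) + V i \<bullet> d < \<mu>"
        then have "lat_pair (v i) b = 0" by (intro low) (auto simp: c_def)
        then show "V i \<bullet> x = 0" using Re_pair[of i] by simp
      qed
      define q where "q i = lat_pair (v i) z - 1" for i
      have qO: "q i \<in> gp_O \<nu>" for i
        using \<nu>(1) \<open>\<not> \<nu> > 0\<close> unfolding q_def
        by (intro gp_O_diff gp_O_lat_pair) (auto intro: gp_O_mono[OF gp_O_one])
      \<comment> \<open>The constant 1 in \<open>q\<close> is visible at order \<open>\<nu>\<close>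
        only if \<open>\<nu> = 0\<close>.\<close>
      define \<kappa> :: real where "\<kappa> = (if \<nu> = 0 then 1 else 0)"
      have qc: "gp_coeff (q i) \<nu> = lat_pair (v i) b - of_real \<kappa>" for i
        by (simp add: q_def gp_coeff_lat_pair b_def gp_coeff_one \<kappa>_def)
      have coeff: "Re (cnj (lat_pair (v i) b) * gp_coeff (m i * q i) (\<mu> + \<nu>)) =
          (if c i = \<mu> then G i * (cmod (lat_pair (v i) b))\<^sup>2 - \<kappa> * (G i * (V i \<bullet> x)) else 0)"
        if i: "i \<in> {1..n}" for i
      proof -
        have mO: "m i \<in> gp_O (c i)" using gp_O_val[of "m i"] m(2)[OF i] by simp
        consider "c i < \<mu>" | "c i = \<mu>" | "c i > \<mu>" by linarith
        then show ?thesis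
        proof cases
          case 1
          then show ?thesis using low[OF i] by simp
        next
          case 2
          have "gp_coeff (m i) \<mu> = of_real (G i)" using m(2,3)[OF i] 2 by (simp add: gp_lead_def)
          then have eq: "gp_coeff (m i * q i) (\<mu> + \<nu>) = of_real (G i) * (lat_pair (v i) b - of_real \<kappa>)"
            using gp_coeff_mult_O[OF mO qO] 2 by (simp add: qc)
          have "cnj (lat_pair (v i) b) * gp_coeff (m i * q i) (\<mu> + \<nu>) =
              of_real (G i) * (lat_pair (v i) b * cnj (lat_pair (v i) b)) - of_real (G i * \<kappa>) * cnj (lat_pair (v i) b)"
            unfolding eq by (simp add: algebra_simps)
          also have "Re \<dots> = G i * (cmod (lat_pair (v i) b))\<^sup>2 - \<kappa> * (G i * (V i \<bullet> x))"
            by (simp add: complex_norm_square[symmetric] Re_pair)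
          finally show ?thesis using 2 by simp
        next
          case 3
          then have "gp_coeff (m i * q i) (\<mu> + \<nu>) = 0"
            using gp_O_mult[OF mO qO] by (simp add: gp_O_def)
          then show ?thesis using 3 by simp
        qed
      qed
      have "0 = gp_coeff (\<Sum>i=1..n. gp_monom (lat_pair (v i) (\<chi> l. cnj (b $ l))) 0 * (m i * q i)) (\<mu> + \<nu>)"
        using gp_balanced_pair[OF z, of "\<chi> l. cnj (b $ l)"] by (simp add: q_def del: gp_coeff_sum)
      also have "\<dots> = (\<Sum>i=1..n. cnj (lat_pair (v i) b) * gp_coeff (m i * q i) (\<mu> + \<nu>))"
        by (simp add: lat_pair_cnj)
      finally have "0 = (\<Sum>i=1..n. Re (cnj (lat_pair (v i) b) * gp_coeff (m i * q i) (\<mu> + \<nu>)))"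
        by (metis Re_sum zero_complex.simps(1))
      also have "\<dots> = (\<Sum>i=1..n. if c i = \<mu> then G i * (cmod (lat_pair (v i) b))\<^sup>2 - \<kappa> * (G i * (V i \<bullet> x)) else 0)"
        using coeff by (rule sum.cong[OF refl])
      also have "\<dots> = (\<Sum>i | i \<in> {1..n} \<and> c i = \<mu>. G i * (cmod (lat_pair (v i) b))\<^sup>2 - \<kappa> * (G i * (V i \<bullet> x)))"
        by (rule sum.inter_filter[symmetric]) simp
      \<comment> \<open>The tropical condition removes the linear part; the remaining weighted sum
        of squared moduli is positive, contradicting the equation.\<close>
      also have "\<dots> = (\<Sum>i | i \<in> {1..n} \<and> c i = \<mu>. G i * (cmod (lat_pair (v i) b))\<^sup>2)"
        using G0 by (simp add: sum_subtractf flip: sum_distrib_left)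
      also have "\<dots> > 0"
        using k m(4) by (intro sum_pos2[of _ k]) (auto simp: J_def less_imp_le)
      finally show False by simp
    qed
    with \<nu>(1) show ?thesis by blast
  qed
  then obtain \<mu> where \<mu>: "\<mu> > 0" "\<And>j. z $ j \<in> gp_O \<mu>" by blast
  obtain x :: "gpuiseux ^ 'r" where x: "\<And>j. x $ j \<in> gp_pos" "gp_balanced n v (\<lambda>i. m i * gp_mon x (v i))"
    using gp_newton_limit[OF v m(1) \<mu>(2,1) z] by blast
  define X where "X = (\<chi> j. T $ j * x $ j)"
  have X: "X $ j \<in> gp_pos" for j using T x(1) by (simp add: X_def gp_pos_mult)
  have "gp_mon X w = gp_mon T w * gp_mon x w" for w unfolding X_def by (rule gp_mon_mult)
  then have "gp_balanced n v (\<lambda>i. \<gamma> i * gp_mon X (v i))" using x(2) by (simp add: m_def mult.assoc)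
  moreover have "gp_mon X \<in> torus_points gp_pos"
    using gp_mon_pos[OF X] gp_mon_add[of X] gp_posD(1)[OF X] by (auto simp: torus_points_def)
  ultimately show ?thesis unfolding positive_critical_point_iff by blast
qed

theorem proposition5p1:
  fixes n :: nat
    and \<gamma> :: "nat \<Rightarrow> gpuiseux"
    and v :: "nat \<Rightarrow> int ^ 'r"
  assumes "inj_on v {1..n}"
    and "\<And>i. i \<in> {1..n} \<Longrightarrow> \<gamma> i \<in> puiseux_pos"
    and "complete_exponents n v"
  shows "(\<exists>!p. positive_critical_point n \<gamma> v p) \<and>
         p_crit n \<gamma> v \<in> torus_points puiseux_pos \<and>
         torus_val (p_crit n \<gamma> v) \<in> rational_points"
proof -
  have \<gamma>: "\<gamma> i \<in> gp_pos" if "i \<in> {1..n}" for i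
    using assms(2)[OF that] by (simp add: puiseux_pos_def)
  have "\<exists>p. positive_critical_point n \<gamma> v p"
    by (rule positive_critical_point_exists[OF assms(3)]) (rule \<gamma>)
  moreover have "p = q" if "positive_critical_point n \<gamma> v p" "positive_critical_point n \<gamma> v q" for p q
    by (rule positive_critical_point_unique[OF assms(3) _ that]) (rule \<gamma>)
  ultimately have ex1: "\<exists>!p. positive_critical_point n \<gamma> v p" by blast
  then have crit: "positive_critical_point n \<gamma> v (p_crit n \<gamma> v)"
    unfolding p_crit_def by (rule theI')
  have "p_crit n \<gamma> v \<in> torus_points puiseux_pos"
    by (rule positive_critical_point_puiseux(1)[OF assms(3) _ crit]) (rule assms(2))
  moreover have "torus_val (p_crit n \<gamma> v) \<in> rational_points"
    by (rule positive_critical_point_puiseux(2)[OF assms(3) _ crit]) (rule assms(2))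
  ultimately show ?thesis using ex1 by blast
qed

end
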